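(* Let $1\to A\to G\to Q\to 1$ be a short exact sequence of groups with $A$ and $Q$ abelian. If $G$ is finitely presented, then its virtual first betti number $\mathrm{vb}_1(G)$ is finite.
   Context: For a finitely generated group $G$, the virtual first betti number is $\mathrm{vb}_1(G)=\sup\{\dim_{\mathbb{Q}} H_1(S,\mathbb{Q}) \mid S\le G \text{ a subgroup of finite index}\}\in\mathbb{N}\cup\{\infty\}$. *)

theory Defs
  imports
    "HOL-Algebra.AbelCoset"
    "HOL-Library.Poly_Mapping"
    "HOL-Library.Extended_Nat"
    "Jordan_Normal_Form.Missing_VectorSpace"
begin

section \<open>Finitely presented groups\<close>

text \<open>The letter \<open>(x, True)\<close> stands for the generator \<open>x\<close> and \<open>(x, False)\<close> for its inverse.\<close>

type_synonym 'x gword = "('x \<times> bool) list"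

definition cancelling :: "'x \<times> bool \<Rightarrow> 'x \<times> bool \<Rightarrow> bool" where
  "cancelling a b \<longleftrightarrow> fst a = fst b \<and> snd a \<noteq> snd b"

definition reduced :: "'x gword \<Rightarrow> bool" where
  "reduced = successively (\<lambda>a b. \<not> cancelling a b)"

fun reduced_Cons :: "'x \<times> bool \<Rightarrow> 'x gword \<Rightarrow> 'x gword" where
  "reduced_Cons a [] = [a]"
| "reduced_Cons a (b # w) = (if cancelling a b then w else a # b # w)"

text \<open>The product is the reduced form of the concatenation.\<close>

definition free_group :: "'x set \<Rightarrow> 'x gword monoid" where
  "free_group X =
     \<lparr>carrier = {w. reduced w \<and> fst ` set w \<subseteq> X},
      monoid.mult = (\<lambda>u v. foldr reduced_Cons u v),
      one = []\<rparr>"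

definition normal_closure :: "('g, 'm) monoid_scheme \<Rightarrow> 'g set \<Rightarrow> 'g set" where
  "normal_closure G R = \<Inter> {N. N \<lhd> G \<and> R \<subseteq> N}"

text \<open>Taking the generators from \<^typ>\<open>nat\<close> is no restriction, as there are only finitely many.\<close>

definition finitely_presented :: "('g, 'm) monoid_scheme \<Rightarrow> bool" where
  "finitely_presented G \<longleftrightarrow>
     (\<exists>(X :: nat set) R. finite X \<and> finite R \<and> R \<subseteq> carrier (free_group X) \<and>
        free_group X Mod normal_closure (free_group X) R \<cong> G)"

lemma reduced_Nil [simp]: "reduced []"
  by (simp add: reduced_def)

lemma reduced_Cons_reduced: "reduced w \<Longrightarrow> reduced (reduced_Cons a w)"
  by (cases w) (auto simp: reduced_def successively_Cons)

lemma reduced_foldr: "reduced v \<Longrightarrow> reduced (foldr reduced_Cons u v)"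
  by (induction u) (auto intro: reduced_Cons_reduced)

lemma set_reduced_Cons: "set (reduced_Cons a w) \<subseteq> insert a (set w)"
  by (cases w) auto

lemma set_foldr_reduced_Cons: "set (foldr reduced_Cons u v) \<subseteq> set u \<union> set v"
  by (induction u) (use set_reduced_Cons in \<open>fastforce+\<close>)

lemma reduced_Cons_cancel:
  assumes "cancelling a b" "reduced w"
  shows "reduced_Cons a (reduced_Cons b w) = w"
proof (cases w)
  case (Cons c w')
  show ?thesis
  proof (cases "cancelling b c")
    case True
    then have "c = a" using assms(1) by (auto simp: cancelling_def prod_eq_iff)
    then show ?thesis using Cons True assms by (cases w') (auto simp: reduced_def)
  qed (use Cons assms in auto)
qed (use assms in auto)

lemma foldr_reduced_Cons:
  assumes "reduced w"
  shows "foldr reduced_Cons (reduced_Cons a r) w = reduced_Cons a (foldr reduced_Cons r w)"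
  by (cases r) (auto simp: reduced_Cons_cancel reduced_foldr assms)

lemma foldr_reduced_Cons_assoc:
  assumes "reduced w"
  shows "foldr reduced_Cons (foldr reduced_Cons u v) w
       = foldr reduced_Cons u (foldr reduced_Cons v w)"
  by (induction u) (auto simp: foldr_reduced_Cons assms)

lemma foldr_reduced_Cons_Nil: "reduced w \<Longrightarrow> foldr reduced_Cons w [] = w"
proof (induction w)
  case (Cons a w)
  then show ?case by (cases w) (auto simp: reduced_def)
qed auto

definition inv_word :: "'x gword \<Rightarrow> 'x gword" where
  "inv_word w = rev (map (\<lambda>(x, e). (x, \<not> e)) w)"

lemma reduced_inv_word: "reduced w \<Longrightarrow> reduced (inv_word w)"
  unfolding reduced_def inv_word_def successively_rev successively_map
  by (erule successively_mono) (auto simp: cancelling_def)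

lemma foldr_inv_word:
  "reduced v \<Longrightarrow> foldr reduced_Cons (inv_word w) (foldr reduced_Cons w v) = v"
  by (induction w arbitrary: v)
     (auto simp: inv_word_def reduced_Cons_cancel reduced_foldr cancelling_def)

lemma group_free_group: "group (free_group X)"
proof (rule groupI)
  fix u assume u: "u \<in> carrier (free_group X)"
  have "inv_word u \<in> carrier (free_group X)"
    using u reduced_inv_word[of u] by (auto simp: free_group_def inv_word_def)
  moreover have "inv_word u \<otimes>\<^bsub>free_group X\<^esub> u = \<one>\<^bsub>free_group X\<^esub>"
    using foldr_inv_word[OF reduced_Nil, of u] u foldr_reduced_Cons_Nil[of u]
    by (simp add: free_group_def)
  ultimately show "\<exists>v\<in>carrier (free_group X). v \<otimes>\<^bsub>free_group X\<^esub> u = \<one>\<^bsub>free_group X\<^esub>"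
    by blast
next
  fix u v assume "u \<in> carrier (free_group X)" "v \<in> carrier (free_group X)"
  then have uv: "reduced v" "fst ` set u \<union> fst ` set v \<subseteq> X"
    by (simp_all add: free_group_def)
  have "fst ` set (foldr reduced_Cons u v) \<subseteq> fst ` set u \<union> fst ` set v"
    using image_mono[OF set_foldr_reduced_Cons[of u v], of fst] by (simp add: image_Un)
  then have "fst ` set (foldr reduced_Cons u v) \<subseteq> X"
    using uv(2) by (rule order_trans)
  then show "u \<otimes>\<^bsub>free_group X\<^esub> v \<in> carrier (free_group X)"
    using uv(1) by (simp add: free_group_def reduced_foldr)
qed (simp_all add: free_group_def foldr_reduced_Cons_assoc)

section \<open>Homology with rational coefficients\<close>

definition rat_field :: "rat ring" where
  "rat_field = \<lparr>carrier = UNIV, monoid.mult = (*), one = 1, ring.zero = 0, ring.add = (+)\<rparr>"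

definition rat_scale :: "rat \<Rightarrow> ('a \<Rightarrow>\<^sub>0 rat) \<Rightarrow> ('a \<Rightarrow>\<^sub>0 rat)" where
  "rat_scale r = Poly_Mapping.map ((*) r)"

text \<open>
  A record \<^typ>\<open>('r, 'v) module\<close> extends a ring record; its fields \<open>mult\<close> and \<open>one\<close> play no role for
  modules and are left unspecified. The union in \<open>smult\<close> is the coset \<open>B +> r \<odot> v\<close> for any
  representative \<open>v\<close> (it equals \<open>B\<close>, not \<open>{0}\<close>, when \<open>r = 0\<close>).
\<close>

definition quotient_module :: "('r, 'v) module \<Rightarrow> 'v set \<Rightarrow> ('r, 'v set) module" where
  "quotient_module M B =
     \<lparr>carrier = a_rcosets\<^bsub>M\<^esub> B, monoid.mult = undefined, one = undefined,
      ring.zero = B, ring.add = set_add M,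
      smult = (\<lambda>r V. \<Union>v\<in>V. B +>\<^bsub>M\<^esub> (r \<odot>\<^bsub>M\<^esub> v))\<rparr>"

text \<open>
  The (inhomogeneous) bar complex of \<open>G\<close> with trivial coefficients in the rationals: degree \<open>n\<close> is
  the vector space with basis the \<open>n\<close>-tuples \<open>[g\<^sub>1|...|g\<^sub>n]\<close> of elements of \<open>G\<close>, represented as
  lists, and the differential maps \<open>[g\<^sub>1|...|g\<^sub>n]\<close> to the alternating sum of its faces
  \<open>[g\<^sub>2|...|g\<^sub>n]\<close>, \<open>[g\<^sub>1|...|g\<^sub>i g\<^sub>i\<^sub>+\<^sub>1|...|g\<^sub>n]\<close> for \<open>0 < i < n\<close>, and \<open>[g\<^sub>1|...|g\<^sub>n\<^sub>-\<^sub>1]\<close>.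
\<close>

definition bar_chains :: "('g, 'm) monoid_scheme \<Rightarrow> nat \<Rightarrow> (rat, 'g list \<Rightarrow>\<^sub>0 rat) module" where
  "bar_chains G n =
     \<lparr>carrier = {c. \<forall>gs\<in>Poly_Mapping.keys c. length gs = n \<and> set gs \<subseteq> carrier G},
      monoid.mult = undefined, one = undefined, ring.zero = 0, ring.add = (+), smult = rat_scale\<rparr>"

definition bar_face :: "('g, 'm) monoid_scheme \<Rightarrow> 'g list \<Rightarrow> nat \<Rightarrow> 'g list" where
  "bar_face G gs i =
     (if i = 0 then tl gs
      else if i = length gs then butlast gs
      else take (i - 1) gs @ (gs ! (i - 1) \<otimes>\<^bsub>G\<^esub> gs ! i) # drop (i + 1) gs)"

definition bar_basis_boundary :: "('g, 'm) monoid_scheme \<Rightarrow> 'g list \<Rightarrow> ('g list \<Rightarrow>\<^sub>0 rat)" where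
  "bar_basis_boundary G gs =
     (if gs = [] then 0
      else \<Sum>i\<le>length gs. Poly_Mapping.single (bar_face G gs i) ((-1) ^ i))"

definition bar_boundary ::
    "('g, 'm) monoid_scheme \<Rightarrow> ('g list \<Rightarrow>\<^sub>0 rat) \<Rightarrow> ('g list \<Rightarrow>\<^sub>0 rat)" where
  "bar_boundary G c =
     (\<Sum>gs\<in>Poly_Mapping.keys c. rat_scale (Poly_Mapping.lookup c gs) (bar_basis_boundary G gs))"

definition bar_cycles :: "('g, 'm) monoid_scheme \<Rightarrow> nat \<Rightarrow> ('g list \<Rightarrow>\<^sub>0 rat) set" where
  "bar_cycles G n = {c \<in> carrier (bar_chains G n). bar_boundary G c = 0}"

definition bar_boundaries :: "('g, 'm) monoid_scheme \<Rightarrow> nat \<Rightarrow> ('g list \<Rightarrow>\<^sub>0 rat) set" where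
  "bar_boundaries G n = bar_boundary G ` carrier (bar_chains G (Suc n))"

definition rational_homology ::
    "('g, 'm) monoid_scheme \<Rightarrow> nat \<Rightarrow> (rat, ('g list \<Rightarrow>\<^sub>0 rat) set) module" where
  "rational_homology G n =
     quotient_module ((bar_chains G n)\<lparr>carrier := bar_cycles G n\<rparr>) (bar_boundaries G n)"

lemma field_rat_field: "field rat_field"
proof -
  have "\<exists>y. y + x = 0" for x :: rat
    by (rule exI[of _ "- x"]) simp
  then have "cring rat_field"
    by (intro cringI abelian_groupI comm_monoidI) (auto simp: rat_field_def algebra_simps)
  moreover have "\<exists>y. x * y = 1" if "x \<noteq> 0" for x :: rat
    by (rule exI[of _ "inverse x"]) (use that in simp)
  ultimately show ?thesis
    by (intro cring.cring_fieldI2) (auto simp: rat_field_def)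
qed

lemma module_quotient_module:
  assumes "Module.module R M" and sub: "Module.submodule B R M"
  shows "Module.module R (quotient_module M B)"
proof -
  interpret M: Module.module R M by fact
  interpret B: abelian_subgroup B M
    by (intro abelian_subgroupI3 additive_subgroupI Module.submodule.axioms(1)[OF sub]
        M.abelian_group_axioms)
  have smult: "(\<Union>w\<in>B +>\<^bsub>M\<^esub> v. B +>\<^bsub>M\<^esub> (r \<odot>\<^bsub>M\<^esub> w)) = B +>\<^bsub>M\<^esub> (r \<odot>\<^bsub>M\<^esub> v)"
    if "r \<in> carrier R" "v \<in> carrier M" for r v
  proof -
    have "B +>\<^bsub>M\<^esub> (r \<odot>\<^bsub>M\<^esub> w) = B +>\<^bsub>M\<^esub> (r \<odot>\<^bsub>M\<^esub> v)" if w: "w \<in> B +>\<^bsub>M\<^esub> v" for w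
    proof -
      obtain b where b: "b \<in> B" "w = b \<oplus>\<^bsub>M\<^esub> v"
        using w by (auto simp: a_r_coset_def')
      have "r \<odot>\<^bsub>M\<^esub> b \<in> B"
        using Module.submodule.smult_closed[OF sub] b \<open>r \<in> carrier R\<close> by blast
      moreover have "r \<odot>\<^bsub>M\<^esub> w = r \<odot>\<^bsub>M\<^esub> b \<oplus>\<^bsub>M\<^esub> r \<odot>\<^bsub>M\<^esub> v"
        using b \<open>r \<in> carrier R\<close> \<open>v \<in> carrier M\<close> B.a_Hcarr by (simp add: M.smult_r_distr)
      ultimately have "r \<odot>\<^bsub>M\<^esub> w \<in> B +>\<^bsub>M\<^esub> (r \<odot>\<^bsub>M\<^esub> v)"
        by (auto simp: a_r_coset_def')
      then show ?thesis
        using M.a_repr_independence[OF _ _ Module.submodule.axioms(1)[OF sub]]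
          \<open>r \<in> carrier R\<close> \<open>v \<in> carrier M\<close> by (metis M.smult_closed)
    qed
    moreover have "v \<in> B +>\<^bsub>M\<^esub> v"
      using B.a_rcos_self that by blast
    ultimately show ?thesis by blast
  qed
  interpret Q: comm_group "M A_Mod B"
    by (rule B.a_factorgroup_is_comm_group)
  have ops: "carrier (quotient_module M B) = carrier (M A_Mod B)"
      "x \<oplus>\<^bsub>quotient_module M B\<^esub> y = x \<otimes>\<^bsub>M A_Mod B\<^esub> y"
      "\<zero>\<^bsub>quotient_module M B\<^esub> = \<one>\<^bsub>M A_Mod B\<^esub>" for x y
    by (simp_all add: quotient_module_def A_FactGroup_def FactGroup_def A_RCOSETS_def set_add_def)
  have "abelian_group (quotient_module M B)"
    by (intro abelian_groupI; unfold ops)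
       (fact Q.m_closed Q.one_closed Q.m_assoc Q.m_comm Q.l_one Q.l_inv_ex)+
  moreover have
      "carrier (quotient_module M B) = (\<lambda>v. B +>\<^bsub>M\<^esub> v) ` carrier M"
      "\<And>r v. r \<in> carrier R \<Longrightarrow> v \<in> carrier M \<Longrightarrow>
         r \<odot>\<^bsub>quotient_module M B\<^esub> (B +>\<^bsub>M\<^esub> v) = B +>\<^bsub>M\<^esub> (r \<odot>\<^bsub>M\<^esub> v)"
      "\<And>v w. v \<in> carrier M \<Longrightarrow> w \<in> carrier M \<Longrightarrow>
         (B +>\<^bsub>M\<^esub> v) \<oplus>\<^bsub>quotient_module M B\<^esub> (B +>\<^bsub>M\<^esub> w) = B +>\<^bsub>M\<^esub> (v \<oplus>\<^bsub>M\<^esub> w)"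
    using smult B.a_rcos_sum by (auto simp: quotient_module_def A_RCOSETS_def')
  ultimately show ?thesis
    by (intro moduleI M.R.is_cring)
       (auto simp: M.smult_l_distr M.smult_r_distr M.smult_assoc1)
qed

lemma lookup_rat_scale [simp]: "Poly_Mapping.lookup (rat_scale r c) k = r * Poly_Mapping.lookup c k"
  by (simp add: rat_scale_def Poly_Mapping.map.rep_eq when_def)

lemma keys_rat_scale: "Poly_Mapping.keys (rat_scale r c) \<subseteq> Poly_Mapping.keys c"
  by (auto simp: in_keys_iff)

lemma rat_scale_simps:
  "rat_scale (r + s) c = rat_scale r c + rat_scale s c"
  "rat_scale r (c + d) = rat_scale r c + rat_scale r d"
  "rat_scale (r * s) c = rat_scale r (rat_scale s c)"
  "rat_scale 1 c = c" "rat_scale 0 c = 0" "rat_scale r 0 = 0"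
  by (rule poly_mapping_eqI; simp add: lookup_add algebra_simps)+

lemma rat_scale_sum: "rat_scale r (sum f I) = (\<Sum>i\<in>I. rat_scale r (f i))"
  by (induction I rule: infinite_finite_induct) (auto simp: rat_scale_simps)

lemma add_bar_chains:
  assumes "c \<in> carrier (bar_chains G n)" "d \<in> carrier (bar_chains G n)"
  shows "c + d \<in> carrier (bar_chains G n)"
proof -
  have "gs \<in> Poly_Mapping.keys c \<union> Poly_Mapping.keys d" if "gs \<in> Poly_Mapping.keys (c + d)" for gs
    using that Poly_Mapping.keys_add[of c d] by blast
  then show ?thesis
    using assms unfolding bar_chains_def by force
qed

lemma rat_scale_bar_chains:
  "c \<in> carrier (bar_chains G n) \<Longrightarrow> rat_scale r c \<in> carrier (bar_chains G n)"
  using subsetD[OF keys_rat_scale[of r c]] by (simp add: bar_chains_def)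

lemma sum_bar_chains:
  assumes "\<And>i. i \<in> I \<Longrightarrow> c i \<in> carrier (bar_chains G n)"
  shows "sum c I \<in> carrier (bar_chains G n)"
  using assms
proof (induction I rule: infinite_finite_induct)
  case (insert i I)
  then have "c i \<in> carrier (bar_chains G n)" "sum c I \<in> carrier (bar_chains G n)"
    by blast+
  then show ?case
    using insert.hyps by (simp add: add_bar_chains)
qed (simp_all add: bar_chains_def)

lemma bar_chains_ops:
  "0 \<in> carrier (bar_chains G n)"
  "c \<oplus>\<^bsub>bar_chains G n\<^esub> d = c + d"
  "\<zero>\<^bsub>bar_chains G n\<^esub> = 0"
  "r \<odot>\<^bsub>bar_chains G n\<^esub> c = rat_scale r c"
  by (simp_all add: bar_chains_def)

lemma rat_scale_minus_1: "rat_scale (-1) c + c = 0"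
  using rat_scale_simps(1)[of "-1" 1 c] by (simp add: rat_scale_simps)

lemma module_bar_chains: "Module.module rat_field (bar_chains G n)"
proof (rule moduleI)
  show "cring rat_field"
    using field_rat_field by (simp add: field_def domain_def)
  show "abelian_group (bar_chains G n)"
  proof (rule abelian_groupI; unfold bar_chains_ops)
    show "\<exists>d\<in>carrier (bar_chains G n). d + c = 0" if "c \<in> carrier (bar_chains G n)" for c
      using rat_scale_minus_1 rat_scale_bar_chains[OF that] by blast
  qed (simp_all add: add_bar_chains bar_chains_ops add_ac)
qed (simp_all only: bar_chains_ops rat_scale_bar_chains rat_field_def rat_scale_simps
      ring.simps partial_object.simps monoid.simps)

lemma bar_boundary_superset:
  assumes "finite I" "Poly_Mapping.keys c \<subseteq> I"
  shows "bar_boundary G c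
       = (\<Sum>gs\<in>I. rat_scale (Poly_Mapping.lookup c gs) (bar_basis_boundary G gs))"
  unfolding bar_boundary_def using assms
  by (intro sum.mono_neutral_left) (auto simp: in_keys_iff rat_scale_simps)

lemma bar_boundary_add: "bar_boundary G (c + d) = bar_boundary G c + bar_boundary G d"
proof -
  let ?I = "Poly_Mapping.keys c \<union> Poly_Mapping.keys d"
  have "finite ?I" "Poly_Mapping.keys (c + d) \<subseteq> ?I"
    by (auto dest!: subsetD[OF Poly_Mapping.keys_add])
  then show ?thesis
    by (simp add: bar_boundary_superset[of ?I] lookup_add rat_scale_simps sum.distrib)
qed

lemma bar_boundary_scale: "bar_boundary G (rat_scale r c) = rat_scale r (bar_boundary G c)"
  by (simp add: bar_boundary_superset[OF finite_keys keys_rat_scale] bar_boundary_def[of G c]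
      rat_scale_simps rat_scale_sum)

lemma bar_cycles_1: "bar_cycles G 1 = carrier (bar_chains G 1)"
proof -
  have "bar_basis_boundary G [g] = 0" for g
    by (simp add: bar_basis_boundary_def bar_face_def flip: single_add)
  then have "bar_basis_boundary G gs = 0" if "length gs = 1" for gs
    using that by (cases gs) auto
  then show ?thesis
    by (auto simp: bar_cycles_def bar_boundary_def bar_chains_def rat_scale_simps intro!: sum.neutral)
qed

lemma bar_basis_boundary_2:
  "bar_basis_boundary G [g, h]
     = Poly_Mapping.single [h] 1 - Poly_Mapping.single [g \<otimes>\<^bsub>G\<^esub> h] 1 + Poly_Mapping.single [g] 1"
  by (simp add: bar_basis_boundary_def bar_face_def numeral_2_eq_2 flip: single_uminus)

lemma vectorspace_rational_homology_1:
  assumes "group G"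
  shows "vectorspace rat_field (rational_homology G 1)"
proof -
  interpret group G by fact
  interpret C: Module.module rat_field "bar_chains G 1" by (rule module_bar_chains)
  have bb: "bar_basis_boundary G gs \<in> carrier (bar_chains G 1)"
    if "length gs = 2" "set gs \<subseteq> carrier G" for gs
  proof -
    obtain g h where gs: "gs = [g, h]"
      using \<open>length gs = 2\<close> by (auto simp: length_Suc_conv numeral_2_eq_2)
    have "Poly_Mapping.keys (bar_basis_boundary G gs) \<subseteq> {[h], [g \<otimes>\<^bsub>G\<^esub> h], [g]}"
      unfolding gs bar_basis_boundary_2
      by (auto simp: in_keys_iff lookup_add lookup_minus lookup_single when_def split: if_splits)
    then show ?thesis
      using that gs by (auto simp: bar_chains_def)
  qed
  have in_chains: "bar_boundary G c \<in> carrier (bar_chains G 1)"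
    if "c \<in> carrier (bar_chains G (Suc 1))" for c
    unfolding bar_boundary_def
    by (intro sum_bar_chains rat_scale_bar_chains bb) (use that in \<open>auto simp: bar_chains_def\<close>)
  have "Module.submodule (bar_boundaries G 1) rat_field (bar_chains G 1)"
  proof (intro C.submoduleI)
    show "bar_boundaries G 1 \<subseteq> carrier (bar_chains G 1)"
      using in_chains by (auto simp: bar_boundaries_def)
  next
    have "bar_boundary G 0 \<in> bar_boundaries G 1"
      unfolding bar_boundaries_def by (intro imageI bar_chains_ops(1))
    then show "\<zero>\<^bsub>bar_chains G 1\<^esub> \<in> bar_boundaries G 1"
      by (simp add: bar_boundary_def bar_chains_ops)
  next
    fix c assume "c \<in> bar_boundaries G 1"
    then obtain d where d: "d \<in> carrier (bar_chains G (Suc 1))" "c = bar_boundary G d"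
      by (auto simp: bar_boundaries_def)
    have scale: "rat_scale r c \<in> bar_boundaries G 1" for r
      unfolding d(2) bar_boundary_scale[symmetric] bar_boundaries_def
      by (intro imageI rat_scale_bar_chains d(1))
    then show "r \<odot>\<^bsub>bar_chains G 1\<^esub> c \<in> bar_boundaries G 1" for r
      by (simp add: bar_chains_ops)
    have "c \<in> carrier (bar_chains G 1)"
      using d in_chains by simp
    then have "\<ominus>\<^bsub>bar_chains G 1\<^esub> c = rat_scale (-1) c"
      by (intro C.M.minus_equality rat_scale_bar_chains)
         (simp_all only: bar_chains_ops rat_scale_minus_1)
    then show "\<ominus>\<^bsub>bar_chains G 1\<^esub> c \<in> bar_boundaries G 1"
      using scale by simp
    fix c' assume "c' \<in> bar_boundaries G 1"
    then obtain d' where d': "d' \<in> carrier (bar_chains G (Suc 1))" "c' = bar_boundary G d'"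
      by (auto simp: bar_boundaries_def)
    show "c \<oplus>\<^bsub>bar_chains G 1\<^esub> c' \<in> bar_boundaries G 1"
      unfolding bar_chains_ops d(2) d'(2) bar_boundary_add[symmetric] bar_boundaries_def
      by (intro imageI add_bar_chains d(1) d'(1))
  qed
  then have "Module.module rat_field (rational_homology G 1)"
    using module_quotient_module[OF module_bar_chains[of G 1]] bar_cycles_1[of G]
    by (simp add: rational_homology_def)
  then show ?thesis
    by (simp add: vectorspace_def field_rat_field)
qed

text \<open>The constant \<^const>\<open>vectorspace.dim\<close> has no meaning for spaces of infinite dimension.\<close>

definition edim :: "('k, 'a) ring_scheme \<Rightarrow> ('k, 'v, 'b) module_scheme \<Rightarrow> enat" where
  "edim K V = (if vectorspace.fin_dim K V then enat (vectorspace.dim K V) else \<infinity>)"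

definition vb1 :: "('g, 'm) monoid_scheme \<Rightarrow> enat" where
  "vb1 G = (SUP S \<in> {S. subgroup S G \<and> finite (rcosets\<^bsub>G\<^esub> S)}.
              edim rat_field (rational_homology (G\<lparr>carrier := S\<rparr>) 1))"

end

theory Submission
  imports Defs Complex_Main "HOL-Library.Function_Algebras" "HOL-Algebra.Generated_Groups"
begin

text \<open>
  The group \<open>G\<close> is an extension of an abelian group \<open>Q\<close> by an abelian normal subgroup \<open>A\<close>. Write
  \<open>V\<close> for the rational \<open>Q\<close>-module given by \<open>A\<close>. A subgroup \<open>S\<close> of finite index maps onto a subgroup
  \<open>Q'\<close> of finite index in \<open>Q\<close>, and the dimension of the first homology of \<open>S\<close> is at most the rank
  of \<open>Q\<close> plus the dimension of the coinvariants of \<open>V\<close> under \<open>Q'\<close>. Dually, the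
  \<open>Q'\<close>-invariant additive functions from \<open>A\<close> to the complex numbers are sums of
  eigenfunctionals for characters of \<open>Q\<close> of finite order. It therefore suffices that only finitely
  many unitary characters have a nonzero eigenfunctional and that each of them has a
  finite-dimensional space of eigenfunctionals (\<open>eigenspaces_finite_dim\<close>).

  Both facts come from one finiteness property of the finitely presented group \<open>G\<close>: a
  \<open>G\<close>-invariant biadditive form \<open>\<omega>\<close> on \<open>A\<close> with values in a power of the complex numbers has an
  antisymmetrisation \<open>\<omega> a b - \<omega> b a\<close> with values in a finite-dimensional subspace
  (\<open>form_commutators_finite_dim\<close>). If \<open>f\<close> is an eigenfunctional for the unitary character \<open>\<chi>\<close>, then
  its complex conjugate is one for \<open>\<chi>\<^sup>-\<^sup>1\<close>, and the product of functionals for \<open>\<chi>\<close> and \<open>\<chi>\<^sup>-\<^sup>1\<close> is an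
  invariant form. Infinitely many characters, or an infinite-dimensional eigenspace, would give a
  sequence of such products whose antisymmetrisations are linearly independent, although they
  are the components of a single invariant form
  (\<open>no_independent_invariant_products\<close>).

  To prove the finiteness property, the form is turned into a central extension of \<open>A\<close>, a
  Heisenberg group, in which commutators are given by \<open>\<omega> a b - \<omega> b a\<close>. By coinduction this yields an
  extension of \<open>G\<close> itself by the module \<open>M\<close> of functions on \<open>Q\<close>, where the commutators of lifts of
  elements of \<open>A\<close> are the constant functions with the value \<open>\<omega> a b - \<omega> b a\<close>. Lift the
  map onto \<open>G\<close> from a free group \<open>F\<close> of finite rank to a homomorphism from \<open>F\<close> to the
  extension. It maps the kernel of \<open>F \<rightarrow> G\<close> into the submodule of \<open>M\<close> that is generated by the images of
  the finitely many relators, and the commutators are \<open>Q\<close>-invariants of that submodule. As the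
  complex group algebra of a finitely generated abelian group is Noetherian, the invariants have finite
  dimension (\<open>fixed_vectors_finite_dim\<close>).
\<close>

section \<open>Commuting operators on a vector space\<close>

text \<open>
  A copy of the locale of vector spaces, so that the notions below are not inherited by all of its
  existing interpretations.
\<close>

locale operator_space = vector_space scale
  for scale :: "'a::field \<Rightarrow> 'b::ab_group_add \<Rightarrow> 'b" (infixr \<open>*s\<close> 75)
begin

text \<open>
  A set of commuting operators makes the vector space a module over a polynomial ring; \<open>op_closed\<close>
  are the submodules and \<open>op_span\<close> is the submodule generated by a set.
\<close>

definition op_closed :: "('b \<Rightarrow> 'b) set \<Rightarrow> 'b set \<Rightarrow> bool" where
  "op_closed \<T> N \<longleftrightarrow> subspace N \<and> (\<forall>T\<in>\<T>. T ` N \<subseteq> N)"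

definition op_span :: "('b \<Rightarrow> 'b) set \<Rightarrow> 'b set \<Rightarrow> 'b set" where
  "op_span \<T> S = \<Inter> {N. op_closed \<T> N \<and> S \<subseteq> N}"

lemma op_closedD:
  assumes "op_closed \<T> N"
  shows "subspace N" "\<And>T u. T \<in> \<T> \<Longrightarrow> u \<in> N \<Longrightarrow> T u \<in> N"
  using assms unfolding op_closed_def by auto

lemma op_closedI:
  assumes "subspace N" "\<And>T u. T \<in> \<T> \<Longrightarrow> u \<in> N \<Longrightarrow> T u \<in> N"
  shows "op_closed \<T> N"
  using assms unfolding op_closed_def by auto

lemma op_span_superset: "S \<subseteq> op_span \<T> S"
  by (auto simp: op_span_def)

lemma op_span_minimal: "op_closed \<T> N \<Longrightarrow> S \<subseteq> N \<Longrightarrow> op_span \<T> S \<subseteq> N"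
  by (auto simp: op_span_def)

lemma op_closed_op_span: "op_closed \<T> (op_span \<T> S)"
proof (rule op_closedI)
  show "subspace (op_span \<T> S)"
    unfolding op_span_def by (rule subspace_Inter) (auto dest: op_closedD)
  show "T u \<in> op_span \<T> S" if "T \<in> \<T>" "u \<in> op_span \<T> S" for T u
    using that unfolding op_span_def by (auto dest: op_closedD(2))
qed

lemma op_span_no_ops: "op_span {} S = span S"
proof
  show "op_span {} S \<subseteq> span S"
    by (rule op_span_minimal) (auto simp: op_closed_def span_superset)
  show "span S \<subseteq> op_span {} S"
    using op_closedD(1)[OF op_closed_op_span] op_span_superset by (rule span_minimal[rotated])
qed

text \<open>The chain becomes stationary where it contains the largest independent set.\<close>

lemma subspace_chain_stabilises:
  fixes N :: "nat \<Rightarrow> 'b set"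
  assumes "finite S" "\<And>i. subspace (N i)" "\<And>i j. i \<le> j \<Longrightarrow> N i \<subseteq> N j" "\<And>i. N i \<subseteq> span S"
  shows "\<exists>k. \<forall>i\<ge>k. N i = N k"
proof -
  let ?P = "\<lambda>n. \<exists>B i. B \<subseteq> N i \<and> independent B \<and> finite B \<and> card B = n"
  have bound: "n \<le> card S" if "?P n" for n
    using that independent_span_bound[OF \<open>finite S\<close>] assms(4) by (metis subset_trans)
  have "?P 0" by (auto intro!: exI[of _ "{}"] simp: independent_empty)
  then obtain n where n: "?P n" and max: "\<And>m. ?P m \<Longrightarrow> m \<le> n"
    using Nat.ex_has_greatest_nat[of ?P 0 "card S"] bound by blast
  then obtain B k where B: "B \<subseteq> N k" "independent B" "finite B" "card B = n" by blast
  have "N i \<subseteq> N k" if "k \<le> i" for i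
  proof
    fix v assume v: "v \<in> N i"
    have "v \<in> span B"
    proof (rule ccontr)
      assume *: "v \<notin> span B"
      then have "v \<notin> B" using span_base by blast
      moreover have "insert v B \<subseteq> N i" using B(1) assms(3)[OF that] v by blast
      ultimately have "?P (Suc n)"
        using B independent_insertI[OF * B(2)] by (metis card_insert_disjoint finite_insert)
      then show False using max by fastforce
    qed
    then show "v \<in> N k" using span_minimal[OF B(1) assms(2)] by blast
  qed
  then show ?thesis using assms(3) by blast
qed

text \<open>
  Hilbert's basis theorem in the form needed here: a finitely generated module over a polynomial
  ring, given by commuting operators, satisfies the ascending chain condition. In the induction
  step, \<open>M\<close> is the module generated by \<open>S\<close> under the old operators, \<open>F k\<close> consists of the polynomials
  of degree less than \<open>k\<close> in the new operator with coefficients in \<open>M\<close>, and \<open>L k N\<close> consists of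
  the leading coefficients of the elements of degree \<open>k\<close> of \<open>N\<close>.
\<close>

lemma op_closed_chain_stabilises:
  fixes N :: "nat \<Rightarrow> 'b set"
  assumes "finite \<T>" "finite S"
    and "\<And>T. T \<in> \<T> \<Longrightarrow> Modules.module_hom scale scale T"
    and "\<And>T T' v. T \<in> \<T> \<Longrightarrow> T' \<in> \<T> \<Longrightarrow> T (T' v) = T' (T v)"
    and "\<And>i. op_closed \<T> (N i)" "\<And>i j. i \<le> j \<Longrightarrow> N i \<subseteq> N j" "\<And>i. N i \<subseteq> op_span \<T> S"
  shows "\<exists>k. \<forall>i\<ge>k. N i = N k"
  using assms(1,3-)
proof (induction \<T> arbitrary: N)
  case empty
  then show ?case
    using subspace_chain_stabilises[OF \<open>finite S\<close>, of N] by (simp add: op_span_no_ops op_closed_def)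
next
  case (insert x \<T>)
  define M where "M = op_span \<T> S"
  define F where "F = rec_nat {0} (\<lambda>k U. {u + (x ^^ k) m | u m. u \<in> U \<and> m \<in> M})"
  have F_0: "F 0 = {0}" and F_Suc: "F (Suc k) = {u + (x ^^ k) m | u m. u \<in> F k \<and> m \<in> M}" for k
    by (simp_all add: F_def)
  have x_hom: "Modules.module_hom scale scale x" by (simp add: insert.prems(1))
  have T_hom: "Modules.module_hom scale scale T" if "T \<in> \<T>" for T by (simp add: insert.prems(1) that)
  have pow_hom: "Modules.module_hom scale scale (x ^^ k)" for k
    using x_hom by (induction k) (auto simp: Modules.module_hom_iff)
  have pow_comm: "T ((x ^^ k) v) = (x ^^ k) (T v)" if "T \<in> \<T>" for T k v
    by (induction k) (auto simp: insert.prems(2)[of T x] that)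
  have M: "op_closed \<T> M" by (simp add: M_def op_closed_op_span)
  note subM = op_closedD(1)[OF M]
  note hom_simps = Modules.module_hom.add Modules.module_hom.scale Modules.module_hom.zero Modules.module_hom.neg
  have F: "op_closed \<T> (F k)" for k
  proof (induction k)
    case 0
    show ?case by (rule op_closedI) (auto simp: F_0 subspace_single_0 hom_simps[OF T_hom])
  next
    case (Suc k)
    have "subspace {u + w | u w. u \<in> F k \<and> w \<in> (x ^^ k) ` M}"
      using subspace_sums[OF op_closedD(1)[OF Suc] Modules.module_hom.subspace_image[OF pow_hom subM]] .
    moreover have "{u + w | u w. u \<in> F k \<and> w \<in> (x ^^ k) ` M} = F (Suc k)"
      by (auto simp: F_Suc)
    ultimately have "subspace (F (Suc k))" by simp
    then show ?case
    proof (rule op_closedI)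
      fix T v assume T: "T \<in> \<T>" and "v \<in> F (Suc k)"
      then obtain u m where "v = u + (x ^^ k) m" "u \<in> F k" "m \<in> M" by (auto simp: F_Suc)
      then have "T v = T u + (x ^^ k) (T m)" "T u \<in> F k" "T m \<in> M"
        using T op_closedD(2)[OF Suc] op_closedD(2)[OF M]
        by (auto simp: hom_simps[OF T_hom] pow_comm)
      then show "T v \<in> F (Suc k)" by (auto simp: F_Suc)
    qed
  qed
  note subF = op_closedD(1)[OF F]
  have F_mono: "F k \<subseteq> F (Suc k)" for k
    using subspace_0[OF subM] Modules.module_hom.zero[OF pow_hom] by (force simp: F_Suc)
  have F_mono': "i \<le> j \<Longrightarrow> F i \<subseteq> F j" for i j
    using F_mono by (rule lift_Suc_mono_le)
  have F_x: "x v \<in> F (Suc k)" if "v \<in> F k" for v k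
    using that
  proof (induction k arbitrary: v)
    case 0
    then show ?case using subspace_0[OF subF] by (simp add: F_0 hom_simps[OF x_hom])
  next
    case (Suc k)
    then obtain u m where v: "v = u + (x ^^ k) m" "u \<in> F k" "m \<in> M" by (auto simp: F_Suc)
    then have "x v = x u + (x ^^ Suc k) m" by (simp add: hom_simps[OF x_hom])
    then show ?case using Suc.IH[OF v(2)] v(3) unfolding F_Suc[of "Suc k"] by blast
  qed
  have exhaust: "op_span (insert x \<T>) S \<subseteq> (\<Union>k. F k)"
  proof (rule op_span_minimal)
    show "op_closed (insert x \<T>) (\<Union>k. F k)"
    proof (rule op_closedI)
      show "subspace (\<Union>k. F k)"
      proof (rule subspaceI)
        show "0 \<in> (\<Union>k. F k)" using F_0 by blast
        show "u + v \<in> (\<Union>k. F k)" if "u \<in> (\<Union>k. F k)" "v \<in> (\<Union>k. F k)" for u v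
        proof -
          obtain i j where "u \<in> F i" "v \<in> F j" using \<open>u \<in> _\<close> \<open>v \<in> _\<close> by blast
          then have "u \<in> F (max i j)" "v \<in> F (max i j)"
            using F_mono'[of i "max i j"] F_mono'[of j "max i j"] by auto
          then show ?thesis using subspace_add[OF subF] by blast
        qed
        show "scale c u \<in> (\<Union>k. F k)" if "u \<in> (\<Union>k. F k)" for c u
          using that subspace_scale[OF subF] by blast
      qed
      show "T u \<in> (\<Union>k. F k)" if "T \<in> insert x \<T>" "u \<in> (\<Union>k. F k)" for T u
        using that F_x op_closedD(2)[OF F] by blast
    qed
    have "u \<in> F (Suc 0)" if "u \<in> S" for u
      using that op_span_superset[of S \<T>] by (auto simp: F_Suc F_0 M_def)
    then show "S \<subseteq> (\<Union>k. F k)" by blast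
  qed
  define L where "L = (\<lambda>k N. {m \<in> M. \<exists>u\<in>N. \<exists>v\<in>F k. (x ^^ k) m = u + v})"
  have L_mono: "L k N \<subseteq> L k N'" if "N \<subseteq> N'" for k N N' using that by (auto simp: L_def)
  have L_Suc: "L k N \<subseteq> L (Suc k) N" if N: "op_closed (insert x \<T>) N" for k N
  proof
    fix m assume "m \<in> L k N"
    then obtain u v where "m \<in> M" and uv: "u \<in> N" "v \<in> F k" "(x ^^ k) m = u + v"
      by (auto simp: L_def)
    have "(x ^^ Suc k) m = x u + x v" using uv by (simp add: hom_simps[OF x_hom])
    moreover have "x u \<in> N" using op_closedD(2)[OF N] uv by blast
    ultimately show "m \<in> L (Suc k) N" using F_x uv \<open>m \<in> M\<close> by (auto simp: L_def)
  qed
  have L_mono': "L i N \<subseteq> L j N" if "op_closed (insert x \<T>) N" "i \<le> j" for i j N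
    using lift_Suc_mono_le[of "\<lambda>k. L k N", OF L_Suc] that by blast
  have L_closed: "op_closed \<T> (L k N)" if N: "op_closed (insert x \<T>) N" for k N
  proof (rule op_closedI)
    note subN = op_closedD(1)[OF N]
    have L_alt: "L k N = M \<inter> (x ^^ k) -` {u + v | u v. u \<in> N \<and> v \<in> F k}"
      by (auto simp: L_def)
    show "subspace (L k N)"
      unfolding L_alt
      by (intro subspace_inter subM Modules.module_hom.subspace_vimage[OF pow_hom] subspace_sums subN subF)
    fix T m assume T: "T \<in> \<T>" and "m \<in> L k N"
    then obtain u v where "m \<in> M" and uv: "u \<in> N" "v \<in> F k" "(x ^^ k) m = u + v"
      by (auto simp: L_def)
    then have "(x ^^ k) (T m) = T u + T v"
      by (metis T pow_comm Modules.module_hom.add[OF T_hom[OF T]])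
    moreover have "T u \<in> N" "T v \<in> F k" "T m \<in> M"
      using op_closedD(2)[OF N] op_closedD(2)[OF F] op_closedD(2)[OF M] T uv \<open>m \<in> M\<close> by auto
    ultimately show "T m \<in> L k N" by (auto simp: L_def)
  qed
  have L_detects: "N' \<subseteq> N" if N: "op_closed (insert x \<T>) N" "op_closed (insert x \<T>) N'"
    and sub: "N \<subseteq> N'" "N' \<subseteq> (\<Union>k. F k)" and L: "\<And>k. L k N' \<subseteq> L k N" for N N'
  proof -
    have "n \<in> N" if "n \<in> N'" "n \<in> F k" for n k
      using that
    proof (induction k arbitrary: n)
      case 0
      then show ?case using subspace_0[OF op_closedD(1)[OF N(1)]] by (simp add: F_0)
    next
      case (Suc k)
      then obtain u m where n: "n = u + (x ^^ k) m" "u \<in> F k" "m \<in> M" by (auto simp: F_Suc)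
      then have "(x ^^ k) m = n + (- u)" by simp
      then have "m \<in> L k N'"
        unfolding L_def using n Suc.prems subspace_neg[OF subF n(2)] by blast
      then have "m \<in> L k N" using L by blast
      then obtain n1 v where n1: "n1 \<in> N" "v \<in> F k" "(x ^^ k) m = n1 + v"
        by (auto simp: L_def)
      then have "n - n1 = u + v" by (simp add: n)
      then have "n - n1 \<in> F k" using subspace_add[OF subF n(2) n1(2)] by simp
      moreover have "n - n1 \<in> N'"
        using subspace_diff[OF op_closedD(1)[OF N(2)]] Suc.prems n1 sub by blast
      ultimately have "n - n1 \<in> N" using Suc.IH by blast
      then have "n1 + (n - n1) \<in> N" using subspace_add[OF op_closedD(1)[OF N(1)] n1(1)] by blast
      then show ?case by simp
    qed
    then show ?thesis using sub(2) by blast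
  qed
  have stab: "\<exists>k. \<forall>i\<ge>k. C i = C k"
    if "\<And>i. op_closed \<T> (C i)" "\<And>i j. i \<le> j \<Longrightarrow> C i \<subseteq> C j" "\<And>i. C i \<subseteq> M" for C :: "nat \<Rightarrow> 'b set"
    using insert.IH[of C] insert.prems(1,2) that by (auto simp: M_def)
  note NC = insert.prems(3) and Nmono = insert.prems(4)
  have LM: "L k N \<subseteq> M" for k N by (auto simp: L_def)
  \<comment> \<open>The sets \<open>L k (N i)\<close> increase in both indices: the diagonal settles all \<open>k \<ge> k0\<close>, and the finitely
    many smaller \<open>k\<close> are treated one by one.\<close>
  have "\<exists>k. \<forall>i\<ge>k. L i (N i) = L k (N k)"
    by (rule stab) (use L_closed[OF NC] L_mono'[OF NC] L_mono[OF Nmono] LM in \<open>blast+\<close>)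
  then obtain k0 where k0: "\<And>i. i \<ge> k0 \<Longrightarrow> L i (N i) = L k0 (N k0)" by blast
  have "\<exists>r. \<forall>i\<ge>r. L k (N i) = L k (N r)" for k
    by (rule stab) (use L_closed[OF NC] L_mono[OF Nmono] LM in \<open>blast+\<close>)
  then obtain r where r: "\<And>k i. i \<ge> r k \<Longrightarrow> L k (N i) = L k (N (r k))" by metis
  define K where "K = Max (insert k0 (r ` {..<k0}))"
  have K: "k0 \<le> K" "\<And>k. k < k0 \<Longrightarrow> r k \<le> K" by (auto simp: K_def)
  have L_le: "L k (N i) \<subseteq> L k (N K)" if "K \<le> i" for k i
  proof (cases "k < k0")
    case True
    then show ?thesis using r[of k i] r[of k K] K that by (metis le_trans order_refl)
  next
    case False
    have "L k (N i) \<subseteq> L (max k i) (N (max k i))"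
      using L_mono'[OF NC, of k "max k i"] L_mono[OF Nmono, of i "max k i"] by force
    also have "\<dots> = L k0 (N k0)" using False by (intro k0) auto
    also have "\<dots> \<subseteq> L k (N K)"
      using False L_mono'[OF NC, of k0 k] L_mono[OF Nmono, OF K(1)] by (force simp: not_less)
    finally show ?thesis .
  qed
  have "N i \<subseteq> N K" if "K \<le> i" for i
    using subset_trans[OF insert.prems(5) exhaust] L_le[OF that]
    by (rule L_detects[OF NC NC Nmono[OF that]])
  then have "N i = N K" if "K \<le> i" for i using Nmono[OF that] that by (intro equalityI)
  then show ?case by blast
qed

text \<open>
  In a finitely generated module the vectors fixed by all operators span a space of finite
  dimension, as all subspaces of that space are submodules.
\<close>

lemma fixed_vectors_finite_dim:
  assumes "finite \<T>" "finite S"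
    and hom: "\<And>T. T \<in> \<T> \<Longrightarrow> Modules.module_hom scale scale T"
    and "\<And>T T' v. T \<in> \<T> \<Longrightarrow> T' \<in> \<T> \<Longrightarrow> T (T' v) = T' (T v)"
    and sub: "U \<subseteq> op_span \<T> S" and fixed: "\<And>T u. T \<in> \<T> \<Longrightarrow> u \<in> U \<Longrightarrow> T u = u"
  shows "\<exists>B. finite B \<and> U \<subseteq> span B"
proof (rule ccontr)
  assume "\<not> ?thesis"
  then have "\<exists>v. v \<in> U \<and> v \<notin> span B" if "finite B" for B using that by blast
  then obtain pick where pick: "\<And>B. finite B \<Longrightarrow> pick B \<in> U \<and> pick B \<notin> span B" by metis
  define C where "C = rec_nat {} (\<lambda>_ B. insert (pick B) B)"
  have C: "C 0 = {}" "\<And>i. C (Suc i) = insert (pick (C i)) (C i)" by (simp_all add: C_def)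
  have fin: "finite (C i)" and CU: "C i \<subseteq> U" for i
    by (induction i) (auto simp: C pick)
  have mono: "C i \<subseteq> C j" if "i \<le> j" for i j
    using lift_Suc_mono_le[of C, OF _ that] by (auto simp: C)
  have fixed': "T u = u" if T: "T \<in> \<T>" and "u \<in> span U" for T u
  proof -
    have "subspace {u. T u = u}"
      using Modules.module_hom.zero[OF hom[OF T]] Modules.module_hom.add[OF hom[OF T]]
        Modules.module_hom.scale[OF hom[OF T]] by (auto simp: subspace_def)
    then have "span U \<subseteq> {u. T u = u}" using fixed[OF T] by (intro span_minimal) auto
    then show ?thesis using that by blast
  qed
  have "\<exists>k. \<forall>i\<ge>k. span (C i) = span (C k)"
  proof (rule op_closed_chain_stabilises[where N = "\<lambda>i. span (C i)", OF assms(1,2)])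
    show "Modules.module_hom scale scale T" if "T \<in> \<T>" for T using hom that .
    show "T (T' v) = T' (T v)" if "T \<in> \<T>" "T' \<in> \<T>" for T T' v using assms(4) that .
    show "op_closed \<T> (span (C i))" for i
    proof (rule op_closedI)
      show "T u \<in> span (C i)" if "T \<in> \<T>" "u \<in> span (C i)" for T u
        using fixed'[of T u] span_mono[OF CU[of i]] that by auto
    qed simp
    show "span (C i) \<subseteq> span (C j)" if "i \<le> j" for i j
      using mono[OF that] by (rule span_mono)
    show "span (C i) \<subseteq> op_span \<T> S" for i
      by (rule span_minimal) (use CU sub op_closedD(1)[OF op_closed_op_span] in auto)
  qed
  then obtain k where "span (C (Suc k)) = span (C k)" by (meson le_SucI order_refl)
  then show False using pick[OF fin[of k]] span_base[of "pick (C k)" "C (Suc k)"] by (simp add: C)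
qed

lemma many_vectors_dependent:
  assumes "finite B" "finite I" "card B < card I" "\<And>i. i \<in> I \<Longrightarrow> v i \<in> span B"
  shows "\<exists>c. (\<exists>i\<in>I. c i \<noteq> 0) \<and> (\<Sum>i\<in>I. scale (c i) (v i)) = 0"
proof (cases "inj_on v I")
  case True
  then have "card (v ` I) = card I" by (rule card_image)
  then have "dependent (v ` I)"
    using independent_span_bound[OF assms(1), of "v ` I"] assms by (metis image_subsetI linorder_not_less)
  then obtain u where u: "\<exists>w\<in>v ` I. u w \<noteq> 0" "(\<Sum>w\<in>v ` I. scale (u w) w) = 0"
    using dependent_finite[of "v ` I"] assms(2) by auto
  then show ?thesis
    by (intro exI[of _ "\<lambda>i. u (v i)"]) (auto simp: sum.reindex[OF True] o_def)
next
  case False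
  then obtain i j where ij: "i \<in> I" "j \<in> I" "i \<noteq> j" "v i = v j" by (auto simp: inj_on_def)
  let ?c = "\<lambda>k. if k = i then 1 else if k = j then - 1 else 0"
  have "(\<Sum>k\<in>I. scale (?c k) (v k)) = (\<Sum>k\<in>{i, j}. scale (?c k) (v k))"
    using ij assms(2) by (intro sum.mono_neutral_right) auto
  also have "\<dots> = 0" using ij by simp
  finally show ?thesis using ij by (intro exI[of _ ?c]) auto
qed

end

section \<open>Evaluating words of a free group\<close>

text \<open>The value of a word of a free group under the substitution \<open>e\<close> of group elements for the generators.\<close>

definition letter_val :: "('g, 'm) monoid_scheme \<Rightarrow> ('x \<Rightarrow> 'g) \<Rightarrow> 'x \<times> bool \<Rightarrow> 'g" where
  "letter_val H e l = (if snd l then e (fst l) else inv\<^bsub>H\<^esub> e (fst l))"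

definition word_val :: "('g, 'm) monoid_scheme \<Rightarrow> ('x \<Rightarrow> 'g) \<Rightarrow> 'x gword \<Rightarrow> 'g" where
  "word_val H e w = foldr (\<lambda>l y. letter_val H e l \<otimes>\<^bsub>H\<^esub> y) w \<one>\<^bsub>H\<^esub>"

lemma word_val_simps [simp]:
  "word_val H e [] = \<one>\<^bsub>H\<^esub>"
  "word_val H e (l # w) = letter_val H e l \<otimes>\<^bsub>H\<^esub> word_val H e w"
  by (simp_all add: word_val_def)

context group
begin

lemma letter_val_closed [simp]: "range e \<subseteq> carrier G \<Longrightarrow> letter_val G e l \<in> carrier G"
  by (auto simp: letter_val_def)

lemma word_val_closed [simp]: "range e \<subseteq> carrier G \<Longrightarrow> word_val G e w \<in> carrier G"
  by (induction w) auto

lemma letter_val_cancelling: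
  assumes "range e \<subseteq> carrier G" "cancelling a b"
  shows "letter_val G e a \<otimes> letter_val G e b = \<one>"
proof -
  have "e (fst b) \<in> carrier G" using assms by blast
  then show ?thesis using assms by (auto simp: letter_val_def cancelling_def)
qed

lemma word_val_reduced_Cons:
  assumes "range e \<subseteq> carrier G"
  shows "word_val G e (reduced_Cons a w) = letter_val G e a \<otimes> word_val G e w"
proof (cases w)
  case (Cons b w')
  then show ?thesis
    using letter_val_cancelling[OF assms, of a b] assms
    by (auto simp: m_assoc[symmetric])
qed simp

lemma word_val_mult:
  assumes "range e \<subseteq> carrier G"
  shows "word_val G e (foldr reduced_Cons u v) = word_val G e u \<otimes> word_val G e v"
  by (induction u) (auto simp: word_val_reduced_Cons assms m_assoc)

lemma word_val_hom: "range e \<subseteq> carrier G \<Longrightarrow> word_val G e \<in> hom (free_group X) G"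
  by (rule homI) (auto simp: free_group_def word_val_mult)

lemma free_group_hom_eq_word_val:
  assumes "\<pi> \<in> hom (free_group X) G" "w \<in> carrier (free_group X)"
  shows "\<pi> w = word_val G (\<lambda>x. if x \<in> X then \<pi> [(x, True)] else \<one>) w"
  using assms(2)
proof (induction w)
  case Nil
  interpret F: group "free_group X" by (rule group_free_group)
  interpret group_hom "free_group X" G \<pi>
    by (simp add: group_hom_def group_hom_axioms_def F.is_group is_group assms(1))
  show ?case using hom_one by (simp add: free_group_def)
next
  case (Cons l w)
  interpret F: group "free_group X" by (rule group_free_group)
  interpret group_hom "free_group X" G \<pi>
    by (simp add: group_hom_def group_hom_axioms_def F.is_group is_group assms(1))
  let ?e = "\<lambda>x. if x \<in> X then \<pi> [(x, True)] else \<one>"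
  obtain x b where l: "l = (x, b)" by (cases l)
  have x: "x \<in> X" and w: "w \<in> carrier (free_group X)"
    using Cons.prems l by (auto simp: free_group_def reduced_def successively_Cons)
  have letter: "[(x, c)] \<in> carrier (free_group X)" for c
    using x by (simp add: free_group_def reduced_def)
  have "l # w = [l] \<otimes>\<^bsub>free_group X\<^esub> w"
    using Cons.prems by (cases w) (auto simp: free_group_def reduced_def)
  then have "\<pi> (l # w) = \<pi> [l] \<otimes> \<pi> w"
    using letter w l hom_mult by metis
  moreover have "\<pi> [l] = letter_val G ?e l"
  proof (cases b)
    case False
    have "[(x, False)] \<otimes>\<^bsub>free_group X\<^esub> [(x, True)] = \<one>\<^bsub>free_group X\<^esub>"
      by (simp add: free_group_def cancelling_def)
    then have "[(x, False)] = inv\<^bsub>free_group X\<^esub> [(x, True)]"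
      using letter F.inv_equality by metis
    then show ?thesis using False x l letter by (simp add: letter_val_def)
  qed (simp add: l letter_val_def x)
  ultimately show ?case using Cons.IH[OF w] by simp
qed

lemma word_val_in_generate: "word_val G e w \<in> generate G (range e)"
  by (induction w) (auto simp: letter_val_def intro: generate.intros)

lemma word_val_hom_comp:
  assumes "k \<in> hom G H" "group H" "range e \<subseteq> carrier G"
  shows "k (word_val G e w) = word_val H (k \<circ> e) w"
proof -
  interpret group_hom G H k
    using assms by (simp add: group_hom_def group_hom_axioms_def is_group)
  have "e x \<in> carrier G" for x using assms(3) by blast
  then show ?thesis
    by (induction w) (auto simp: letter_val_def assms(3))
qed

end

text \<open>
  A presentation as a substitution \<open>e\<close>. That the kernel of the evaluation is the normal closure of
  the relators is expressed by its minimality among the normal subgroups that contain them.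
\<close>

lemma finitely_presentedE:
  assumes "finitely_presented G" "group G"
  obtains X :: "nat set" and R and e :: "nat \<Rightarrow> 'g" where
    "finite X" "finite R" "R \<subseteq> carrier (free_group X)"
    "range e \<subseteq> carrier G" "finite (range e)"
    "carrier G = word_val G e ` carrier (free_group X)" "carrier G = generate G (range e)"
    "\<And>w N. w \<in> carrier (free_group X) \<Longrightarrow> word_val G e w = \<one>\<^bsub>G\<^esub> \<Longrightarrow>
       N \<lhd> free_group X \<Longrightarrow> R \<subseteq> N \<Longrightarrow> w \<in> N"
    "\<And>r. r \<in> R \<Longrightarrow> word_val G e r = \<one>\<^bsub>G\<^esub>"
proof -
  interpret G: group G by fact
  obtain X :: "nat set" and R where X: "finite X" "finite R" "R \<subseteq> carrier (free_group X)"
    and iso: "free_group X Mod normal_closure (free_group X) R \<cong> G"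
    using assms(1) unfolding finitely_presented_def by blast
  interpret F: group "free_group X" by (rule group_free_group)
  let ?N = "normal_closure (free_group X) R"
  have carr_normal: "carrier (free_group X) \<lhd> free_group X"
    by (rule F.normal_invI) (auto intro: F.subgroup_self)
  have RN: "R \<subseteq> ?N" by (auto simp: normal_closure_def)
  have "?N \<lhd> free_group X"
  proof (rule F.normal_invI)
    show "subgroup ?N (free_group X)"
      unfolding normal_closure_def using carr_normal X(3)
      by (intro F.subgroups_Inter) (auto intro: normal_imp_subgroup)
    show "x \<otimes>\<^bsub>free_group X\<^esub> n \<otimes>\<^bsub>free_group X\<^esub> inv\<^bsub>free_group X\<^esub> x \<in> ?N"
      if "x \<in> carrier (free_group X)" "n \<in> ?N" for x n
      using that unfolding normal_closure_def by (auto intro: normal.inv_op_closed2)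
  qed
  then interpret N: normal ?N "free_group X" .
  obtain i where i: "i \<in> iso (free_group X Mod ?N) G" using iso by (auto simp: is_iso_def)
  define \<pi> where "\<pi> = i \<circ> (\<lambda>w. ?N #>\<^bsub>free_group X\<^esub> w)"
  interpret Q: group "free_group X Mod ?N" by (rule N.factorgroup_is_group)
  interpret i: group_hom "free_group X Mod ?N" G i
    using i by (auto simp: group_hom_def group_hom_axioms_def iso_def Q.is_group G.is_group)
  have "i \<circ> (\<lambda>w. ?N #>\<^bsub>free_group X\<^esub> w) \<in> hom (free_group X) G"
    using N.r_coset_hom_Mod i.homh by (rule hom_compose)
  then have \<pi>: "\<pi> \<in> hom (free_group X) G" by (simp only: \<pi>_def)
  have inj: "inj_on i (carrier (free_group X Mod ?N))"
    and surj: "i ` carrier (free_group X Mod ?N) = carrier G"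
    using i by (auto simp: iso_def bij_betw_def)
  have carr: "carrier (free_group X Mod ?N) = (\<lambda>w. ?N #>\<^bsub>free_group X\<^esub> w) ` carrier (free_group X)"
    by (auto simp: FactGroup_def RCOSETS_def)
  have \<pi>_one: "\<pi> w = \<one>\<^bsub>G\<^esub> \<longleftrightarrow> w \<in> ?N" if w: "w \<in> carrier (free_group X)" for w
  proof -
    have "\<pi> w = \<one>\<^bsub>G\<^esub> \<longleftrightarrow> ?N #>\<^bsub>free_group X\<^esub> w = ?N"
      using inj_onD[OF inj, of "?N #>\<^bsub>free_group X\<^esub> w" ?N] i.hom_one w Q.one_closed carr
      by (auto simp: \<pi>_def)
    also have "\<dots> \<longleftrightarrow> w \<in> ?N"
      using F.coset_join1[OF _ w N.is_subgroup] F.coset_join2[OF w N.is_subgroup] by blast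
    finally show ?thesis .
  qed
  define e where "e = (\<lambda>x. if x \<in> X then \<pi> [(x, True)] else \<one>\<^bsub>G\<^esub>)"
  have "[(x, True)] \<in> carrier (free_group X)" if "x \<in> X" for x
    using that by (simp add: free_group_def reduced_def)
  then have e: "range e \<subseteq> carrier G"
    using \<pi> by (auto simp: e_def hom_def)
  have eq: "\<pi> w = word_val G e w" if "w \<in> carrier (free_group X)" for w
    using G.free_group_hom_eq_word_val[OF \<pi> that] by (simp add: e_def)
  show thesis
  proof (rule that[of X R e])
    have "range e \<subseteq> insert \<one>\<^bsub>G\<^esub> ((\<lambda>x. \<pi> [(x, True)]) ` X)" by (auto simp: e_def)
    then show "finite (range e)" using X(1) finite_subset by blast
    have "carrier G = \<pi> ` carrier (free_group X)"
      using surj unfolding carr by (auto simp: \<pi>_def image_image)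
    then show *: "carrier G = word_val G e ` carrier (free_group X)"
      using eq by (metis image_cong)
    have "carrier G \<subseteq> generate G (range e)"
      unfolding * by (rule image_subsetI) (rule G.word_val_in_generate)
    then show "carrier G = generate G (range e)"
      using G.generate_incl[OF e] by (rule equalityI)
    show "w \<in> N" if "w \<in> carrier (free_group X)" "word_val G e w = \<one>\<^bsub>G\<^esub>"
      "N \<lhd> free_group X" "R \<subseteq> N" for w N
      using that \<pi>_one[of w] eq[of w] by (auto simp: normal_closure_def)
    show "word_val G e r = \<one>\<^bsub>G\<^esub>" if "r \<in> R" for r
      using that X(3) RN \<pi>_one[of r] eq[of r] by auto
  qed (fact X e)+
qed

section \<open>An extension of a metabelian group by a coinduced module\<close>

text \<open>Complex-valued functions on a type form a vector space.\<close>

definition fscale :: "complex \<Rightarrow> ('z \<Rightarrow> complex) \<Rightarrow> 'z \<Rightarrow> complex" where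
  "fscale c f = (\<lambda>z. c * f z)"

lemma fscale_apply: "fscale c f z = c * f z"
  by (simp add: fscale_def)

global_interpretation funs: operator_space fscale
  by unfold_locales (auto simp: fscale_def fun_eq_iff algebra_simps)

lemma sum_fun_apply: "(\<Sum>i\<in>I. f i) z = (\<Sum>i\<in>I. f i z)" for f :: "'i \<Rightarrow> 'z \<Rightarrow> 'a::comm_monoid_add"
  by (induction I rule: infinite_finite_induct) auto

text \<open>
  An epimorphism from \<open>G\<close> onto the abelian group \<open>Q\<close> with abelian kernel, written \<open>A\<close> below.
\<close>

locale abelian_by_abelian = G: group G + Q: comm_group Q
  for G (structure) and Q (structure) +
  fixes h
  assumes h_epi: "h \<in> epi G Q"
    and kernel_comm: "\<lbrakk>a \<in> kernel G Q h; b \<in> kernel G Q h\<rbrakk> \<Longrightarrow> a \<otimes> b = b \<otimes> a"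
begin

abbreviation "A \<equiv> kernel G Q h"

sublocale h: group_hom G Q h
  using h_epi by (simp add: group_hom_def group_hom_axioms_def epi_def G.is_group Q.is_group)

lemma A_carrier: "a \<in> A \<Longrightarrow> a \<in> carrier G"
  by (simp add: kernel_def)

lemma A_subgroup: "subgroup A G"
  by (rule h.subgroup_kernel)

lemma A_closed [simp]:
  "\<one> \<in> A" "a \<in> A \<Longrightarrow> b \<in> A \<Longrightarrow> a \<otimes> b \<in> A" "a \<in> A \<Longrightarrow> inv a \<in> A"
  using A_subgroup by (auto intro: subgroup.one_closed subgroup.m_closed subgroup.m_inv_closed)

lemma A_conj [simp]: "a \<in> A \<Longrightarrow> g \<in> carrier G \<Longrightarrow> g \<otimes> a \<otimes> inv g \<in> A"
  by (rule normal.inv_op_closed2[OF h.normal_kernel])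

lemma A_conj' [simp]: "a \<in> A \<Longrightarrow> g \<in> carrier G \<Longrightarrow> inv g \<otimes> a \<otimes> g \<in> A"
  by (rule normal.inv_op_closed1[OF h.normal_kernel])

text \<open>A set-theoretic section of the epimorphism.\<close>

definition lift :: "_ \<Rightarrow> _" where
  "lift q = (SOME g. g \<in> carrier G \<and> h g = q)"

lemma lift_props: "q \<in> carrier Q \<Longrightarrow> lift q \<in> carrier G \<and> h (lift q) = q"
proof -
  assume "q \<in> carrier Q"
  then have "q \<in> h ` carrier G" using h_epi by (simp add: epi_def)
  then have "\<exists>g. g \<in> carrier G \<and> h g = q" by (elim imageE) (intro exI conjI, simp_all)
  then show ?thesis unfolding lift_def by (rule someI_ex)
qed

lemmas lift [simp] = lift_props[THEN conjunct1] lift_props[THEN conjunct2]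

text \<open>
  The Kaloujnine--Krasner embedding of \<open>G\<close> into the wreath product of \<open>A\<close> with \<open>Q\<close> sends \<open>g\<close> to
  the pair of the function \<open>kk g\<close> from \<open>Q\<close> to \<open>A\<close> and the image of \<open>g\<close> in \<open>Q\<close>.
\<close>

definition kk :: "_ \<Rightarrow> _ \<Rightarrow> _" where
  "kk g q = inv (lift q) \<otimes> (g \<otimes> lift (inv\<^bsub>Q\<^esub> h g \<otimes>\<^bsub>Q\<^esub> q))"

lemma kk_in_A [simp]:
  assumes "g \<in> carrier G" "q \<in> carrier Q"
  shows "kk g q \<in> A"
proof -
  have "h g \<otimes>\<^bsub>Q\<^esub> (inv\<^bsub>Q\<^esub> h g \<otimes>\<^bsub>Q\<^esub> q) = q"
    using assms by (simp add: Q.m_assoc[symmetric])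
  then show ?thesis
    using assms by (simp add: kk_def kernel_def)
qed

lemma kk_mult:
  assumes "g \<in> carrier G" "g' \<in> carrier G" "q \<in> carrier Q"
  shows "kk (g \<otimes> g') q = kk g q \<otimes> kk g' (inv\<^bsub>Q\<^esub> h g \<otimes>\<^bsub>Q\<^esub> q)"
proof -
  define r where "r = inv\<^bsub>Q\<^esub> h g \<otimes>\<^bsub>Q\<^esub> q"
  define s where "s = inv\<^bsub>Q\<^esub> h g' \<otimes>\<^bsub>Q\<^esub> r"
  have rs: "r \<in> carrier Q" "s \<in> carrier Q" using assms by (auto simp: r_def s_def)
  have s: "inv\<^bsub>Q\<^esub> h (g \<otimes> g') \<otimes>\<^bsub>Q\<^esub> q = s"
    using assms by (simp add: s_def r_def Q.inv_mult Q.m_ac)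
  have "lift r \<otimes> (inv (lift r) \<otimes> (g' \<otimes> lift s)) = g' \<otimes> lift s"
    using assms rs by (simp add: G.m_assoc[symmetric])
  then show ?thesis
    using assms rs unfolding kk_def r_def[symmetric] s_def[symmetric] s by (simp add: G.m_assoc)
qed

lemma kk_kernel: "a \<in> A \<Longrightarrow> q \<in> carrier Q \<Longrightarrow> kk a q = inv (lift q) \<otimes> a \<otimes> lift q"
  by (simp add: kk_def kernel_def G.m_assoc)

lemma kk_one: "q \<in> carrier Q \<Longrightarrow> kk \<one> q = \<one>"
  by (simp add: kk_def)

text \<open>
  Biadditive forms on \<open>A\<close> that are invariant under conjugation by \<open>G\<close>, with values in the complex
  functions on an index type.
\<close>

definition invariant_form :: "(_ \<Rightarrow> _ \<Rightarrow> 'i \<Rightarrow> complex) \<Rightarrow> bool" where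
  "invariant_form \<omega> \<longleftrightarrow>
     (\<forall>a\<in>A. \<forall>b\<in>A. \<forall>c\<in>A. \<omega> (a \<otimes> b) c = \<omega> a c + \<omega> b c \<and> \<omega> c (a \<otimes> b) = \<omega> c a + \<omega> c b) \<and>
     (\<forall>g\<in>carrier G. \<forall>a\<in>A. \<forall>b\<in>A. \<omega> (g \<otimes> a \<otimes> inv g) (g \<otimes> b \<otimes> inv g) = \<omega> a b)"

text \<open>
  The left translation action of \<open>Q\<close> on functions from \<open>Q\<close> to the vector space of values of a form;
  the two arguments are combined into a pair. Functions are zero outside the carrier of \<open>Q\<close>.
\<close>

definition shift :: "_ \<Rightarrow> (_ \<times> 'i \<Rightarrow> complex) \<Rightarrow> (_ \<times> 'i \<Rightarrow> complex)" where
  "shift u m = (\<lambda>(q, i). if q \<in> carrier Q then m (inv\<^bsub>Q\<^esub> u \<otimes>\<^bsub>Q\<^esub> q, i) else 0)"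

lemma shift_hom: "Modules.module_hom fscale fscale (shift u)"
  unfolding shift_def by unfold_locales (auto simp: fun_eq_iff fscale_apply algebra_simps)

lemma shift_shift:
  "u \<in> carrier Q \<Longrightarrow> v \<in> carrier Q \<Longrightarrow> shift u (shift v m) = shift (u \<otimes>\<^bsub>Q\<^esub> v) m"
  by (auto simp: shift_def fun_eq_iff Q.inv_mult Q.m_ac)

text \<open>The factor set \<open>\<omega>\<close> of the Heisenberg group of \<open>\<omega>\<close>, transported along the Kaloujnine--Krasner embedding.\<close>

definition form_cocycle :: "(_ \<Rightarrow> _ \<Rightarrow> 'i \<Rightarrow> complex) \<Rightarrow> _ \<Rightarrow> _ \<Rightarrow> (_ \<times> 'i \<Rightarrow> complex)" where
  "form_cocycle \<omega> g g' =
     (\<lambda>(q, i). if q \<in> carrier Q then \<omega> (kk g q) (kk g' (inv\<^bsub>Q\<^esub> h g \<otimes>\<^bsub>Q\<^esub> q)) i else 0)"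

text \<open>
  The extension of \<open>G\<close> by the module of functions on \<open>Q\<close>, with the cocycle that the form induces.
  It is the preimage of the embedded group \<open>G\<close> under the projection to the wreath product of \<open>A\<close>
  with \<open>Q\<close> from that of the Heisenberg group of \<open>\<omega>\<close> with \<open>Q\<close>.
\<close>

definition form_ext :: "(_ \<Rightarrow> _ \<Rightarrow> 'i \<Rightarrow> complex) \<Rightarrow> ((_ \<times> 'i \<Rightarrow> complex) \<times> _) monoid" where
  "form_ext \<omega> =
     \<lparr>carrier = {(m, g). g \<in> carrier G \<and> (\<forall>q i. q \<notin> carrier Q \<longrightarrow> m (q, i) = 0)},
      monoid.mult = (\<lambda>(m, g) (m', g'). (m + shift (h g) m' + form_cocycle \<omega> g g', g \<otimes> g')),
      one = (0, \<one>)\<rparr>"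

context
  fixes \<omega> :: "_ \<Rightarrow> _ \<Rightarrow> 'i \<Rightarrow> complex"
  assumes \<omega>: "invariant_form \<omega>"
begin

lemma form_add:
  assumes "a \<in> A" "b \<in> A" "c \<in> A"
  shows "\<omega> (a \<otimes> b) c = \<omega> a c + \<omega> b c" "\<omega> c (a \<otimes> b) = \<omega> c a + \<omega> c b"
  using \<omega> assms by (auto simp: invariant_form_def)

lemma form_one: "a \<in> A \<Longrightarrow> \<omega> \<one> a = 0" "a \<in> A \<Longrightarrow> \<omega> a \<one> = 0"
  using form_add[of \<one> \<one> a] by auto

lemma form_conj':
  assumes "a \<in> A" "b \<in> A" "g \<in> carrier G"
  shows "\<omega> (inv g \<otimes> a \<otimes> g) (inv g \<otimes> b \<otimes> g) = \<omega> a b"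
  using \<omega> assms unfolding invariant_form_def by (metis G.inv_closed G.inv_inv)

lemma form_cocycle_one:
  "g \<in> carrier G \<Longrightarrow> form_cocycle \<omega> \<one> g = 0" "g \<in> carrier G \<Longrightarrow> form_cocycle \<omega> g \<one> = 0"
  by (auto simp: form_cocycle_def fun_eq_iff kk_one form_one)

lemma form_cocycle_identity:
  assumes "g \<in> carrier G" "g' \<in> carrier G" "g'' \<in> carrier G"
  shows "shift (h g) (form_cocycle \<omega> g' g'') + form_cocycle \<omega> g (g' \<otimes> g'')
    = form_cocycle \<omega> g g' + form_cocycle \<omega> (g \<otimes> g') g''"
proof (rule ext, clarify)
  fix q i
  have "inv\<^bsub>Q\<^esub> h (g \<otimes> g') \<otimes>\<^bsub>Q\<^esub> q = inv\<^bsub>Q\<^esub> h g' \<otimes>\<^bsub>Q\<^esub> (inv\<^bsub>Q\<^esub> h g \<otimes>\<^bsub>Q\<^esub> q)" if "q \<in> carrier Q"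
    using assms that by (simp add: Q.inv_mult Q.m_ac)
  then show "(shift (h g) (form_cocycle \<omega> g' g'') + form_cocycle \<omega> g (g' \<otimes> g'')) (q, i)
    = (form_cocycle \<omega> g g' + form_cocycle \<omega> (g \<otimes> g') g'') (q, i)"
    using assms by (auto simp: shift_def form_cocycle_def kk_mult form_add)
qed

lemma form_ext_mult:
  "(m, g) \<otimes>\<^bsub>form_ext \<omega>\<^esub> (m', g') = (m + shift (h g) m' + form_cocycle \<omega> g g', g \<otimes> g')"
  and form_ext_one: "\<one>\<^bsub>form_ext \<omega>\<^esub> = (0, \<one>)"
  and form_ext_carrier:
    "(m, g) \<in> carrier (form_ext \<omega>) \<longleftrightarrow> g \<in> carrier G \<and> (\<forall>q i. q \<notin> carrier Q \<longrightarrow> m (q, i) = 0)"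
  by (simp_all add: form_ext_def)

lemma shift_supp: "q \<notin> carrier Q \<Longrightarrow> shift u m (q, i) = 0"
  and form_cocycle_supp: "q \<notin> carrier Q \<Longrightarrow> form_cocycle \<omega> g g' (q, i) = 0"
  by (simp_all add: shift_def form_cocycle_def)

lemma shift_one: "(\<And>q i. q \<notin> carrier Q \<Longrightarrow> m (q, i) = 0) \<Longrightarrow> shift \<one>\<^bsub>Q\<^esub> m = m"
  by (auto simp: shift_def fun_eq_iff)

lemmas shift_add = Modules.module_hom.add[OF shift_hom]

lemma group_form_ext: "group (form_ext \<omega>)"
proof (rule groupI)
  fix X Y Z assume "X \<in> carrier (form_ext \<omega>)" "Y \<in> carrier (form_ext \<omega>)" "Z \<in> carrier (form_ext \<omega>)"
  then obtain m g m' g' m'' g'' where X: "X = (m, g)" "Y = (m', g')" "Z = (m'', g'')"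
    and g: "g \<in> carrier G" "g' \<in> carrier G" "g'' \<in> carrier G"
    by (metis form_ext_carrier surj_pair)
  have *: "shift (h g) m' + shift (h (g \<otimes> g')) m'' + shift (h g) (form_cocycle \<omega> g' g'') + form_cocycle \<omega> g (g' \<otimes> g'')
    = shift (h g) m' + shift (h (g \<otimes> g')) m'' + (form_cocycle \<omega> g g' + form_cocycle \<omega> (g \<otimes> g') g'')"
    using form_cocycle_identity[OF g] by (simp add: add.assoc)
  show "X \<otimes>\<^bsub>form_ext \<omega>\<^esub> Y \<otimes>\<^bsub>form_ext \<omega>\<^esub> Z = X \<otimes>\<^bsub>form_ext \<omega>\<^esub> (Y \<otimes>\<^bsub>form_ext \<omega>\<^esub> Z)"
    using * g by (simp add: X form_ext_mult shift_add shift_shift G.m_assoc add.assoc)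
next
  fix X assume "X \<in> carrier (form_ext \<omega>)"
  then obtain m g where X: "X = (m, g)" and g: "g \<in> carrier G"
    and m: "\<And>q i. q \<notin> carrier Q \<Longrightarrow> m (q, i) = 0"
    by (metis form_ext_carrier surj_pair)
  show "\<one>\<^bsub>form_ext \<omega>\<^esub> \<otimes>\<^bsub>form_ext \<omega>\<^esub> X = X"
    using g by (simp add: X form_ext_mult form_ext_one shift_one m form_cocycle_one)
  let ?Y = "(- (shift (h (inv g)) m + form_cocycle \<omega> (inv g) g), inv g)"
  have "?Y \<in> carrier (form_ext \<omega>)"
    using g by (simp add: form_ext_carrier shift_supp form_cocycle_supp)
  moreover have "?Y \<otimes>\<^bsub>form_ext \<omega>\<^esub> X = \<one>\<^bsub>form_ext \<omega>\<^esub>"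
    using g by (simp add: X form_ext_mult form_ext_one)
  ultimately show "\<exists>Y\<in>carrier (form_ext \<omega>). Y \<otimes>\<^bsub>form_ext \<omega>\<^esub> X = \<one>\<^bsub>form_ext \<omega>\<^esub>" by blast
next
  show "X \<otimes>\<^bsub>form_ext \<omega>\<^esub> Y \<in> carrier (form_ext \<omega>)"
    if "X \<in> carrier (form_ext \<omega>)" "Y \<in> carrier (form_ext \<omega>)" for X Y
    using that by (cases X; cases Y) (simp add: form_ext_mult form_ext_carrier shift_supp form_cocycle_supp)
qed (simp add: form_ext_one form_ext_carrier)

lemma snd_form_ext_hom: "snd \<in> hom (form_ext \<omega>) G"
  by (rule homI) (auto simp: form_ext_def)

lemma form_ext_conj:
  assumes "(n, g) \<in> carrier (form_ext \<omega>)" "(m, \<one>) \<in> carrier (form_ext \<omega>)"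
  shows "(n, g) \<otimes>\<^bsub>form_ext \<omega>\<^esub> (m, \<one>) \<otimes>\<^bsub>form_ext \<omega>\<^esub> inv\<^bsub>form_ext \<omega>\<^esub> (n, g) = (shift (h g) m, \<one>)"
proof -
  interpret E: group "form_ext \<omega>" by (rule group_form_ext)
  have c: "(shift (h g) m, \<one>) \<in> carrier (form_ext \<omega>)"
    using assms by (simp add: form_ext_carrier shift_supp)
  have n: "g \<in> carrier G" "\<And>q i. q \<notin> carrier Q \<Longrightarrow> n (q, i) = 0"
    using assms(1) by (auto simp: form_ext_carrier)
  have "(n, g) \<otimes>\<^bsub>form_ext \<omega>\<^esub> (m, \<one>) = (shift (h g) m, \<one>) \<otimes>\<^bsub>form_ext \<omega>\<^esub> (n, g)"
    using n by (simp add: form_ext_mult form_cocycle_one shift_one n add.commute)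
  then have "(n, g) \<otimes>\<^bsub>form_ext \<omega>\<^esub> (m, \<one>) \<otimes>\<^bsub>form_ext \<omega>\<^esub> inv\<^bsub>form_ext \<omega>\<^esub> (n, g)
    = (shift (h g) m, \<one>) \<otimes>\<^bsub>form_ext \<omega>\<^esub> ((n, g) \<otimes>\<^bsub>form_ext \<omega>\<^esub> inv\<^bsub>form_ext \<omega>\<^esub> (n, g))"
    using assms c by (simp add: E.m_assoc)
  then show ?thesis using assms c by simp
qed

lemma form_ext_commutator:
  assumes "(m, a) \<in> carrier (form_ext \<omega>)" "(n, b) \<in> carrier (form_ext \<omega>)" "a \<in> A" "b \<in> A"
  shows "(m, a) \<otimes>\<^bsub>form_ext \<omega>\<^esub> (n, b) \<otimes>\<^bsub>form_ext \<omega>\<^esub> inv\<^bsub>form_ext \<omega>\<^esub> ((n, b) \<otimes>\<^bsub>form_ext \<omega>\<^esub> (m, a))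
    = (\<lambda>(q, i). if q \<in> carrier Q then (\<omega> a b - \<omega> b a) i else 0, \<one>)"
    (is "_ = (?c, _)")
proof -
  interpret E: group "form_ext \<omega>" by (rule group_form_ext)
  have supp: "\<And>q i. q \<notin> carrier Q \<Longrightarrow> m (q, i) = 0" "\<And>q i. q \<notin> carrier Q \<Longrightarrow> n (q, i) = 0"
    using assms by (auto simp: form_ext_carrier)
  have coc: "form_cocycle \<omega> a b = (\<lambda>(q, i). if q \<in> carrier Q then \<omega> a b i else 0)"
    if "a \<in> A" "b \<in> A" for a b
  proof -
    have "h a = \<one>\<^bsub>Q\<^esub>" using that by (simp add: kernel_def)
    then show ?thesis
      using that by (auto simp: form_cocycle_def fun_eq_iff kk_kernel form_conj')
  qed
  have h: "h a = \<one>\<^bsub>Q\<^esub>" "h b = \<one>\<^bsub>Q\<^esub>" using assms by (auto simp: kernel_def)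
  have c: "(?c, \<one>) \<in> carrier (form_ext \<omega>)" by (simp add: form_ext_carrier)
  have ba: "(n, b) \<otimes>\<^bsub>form_ext \<omega>\<^esub> (m, a) = (n + m + form_cocycle \<omega> b a, b \<otimes> a)"
    by (simp add: form_ext_mult h shift_one supp)
  have "(m, a) \<otimes>\<^bsub>form_ext \<omega>\<^esub> (n, b) = (?c, \<one>) \<otimes>\<^bsub>form_ext \<omega>\<^esub> ((n, b) \<otimes>\<^bsub>form_ext \<omega>\<^esub> (m, a))"
    unfolding ba using assms(3,4) kernel_comm[of a b] supp
    by (simp add: form_ext_mult h shift_one form_cocycle_one A_carrier form_cocycle_supp)
       (auto simp: coc fun_eq_iff)
  then show ?thesis using assms c by (simp add: E.m_assoc)
qed

text \<open>
  Lift the map from a free group onto \<open>G\<close> to the extension. The kernel of the map is sent into the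
  module generated by the images of the finitely many relators. That module contains the commutators
  of the lifts of elements of \<open>A\<close>, which are constant functions and hence fixed by \<open>Q\<close>.
\<close>

proposition form_commutators_finite_dim:
  assumes "finitely_presented G"
  shows "\<exists>B. finite B \<and> (\<forall>a\<in>A. \<forall>b\<in>A. \<omega> a b - \<omega> b a \<in> funs.span B)"
proof -
  obtain X :: "nat set" and R and e where fp: "finite X" "finite R" "R \<subseteq> carrier (free_group X)"
    "range e \<subseteq> carrier G" "finite (range e)"
    "carrier G = word_val G e ` carrier (free_group X)" "carrier G = generate G (range e)"
    and ker: "\<And>w N. w \<in> carrier (free_group X) \<Longrightarrow> word_val G e w = \<one> \<Longrightarrow>
       N \<lhd> free_group X \<Longrightarrow> R \<subseteq> N \<Longrightarrow> w \<in> N"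
    and rel: "\<And>r. r \<in> R \<Longrightarrow> word_val G e r = \<one>"
    using that by (rule finitely_presentedE[OF assms G.is_group])
  interpret E: group "form_ext \<omega>" by (rule group_form_ext)
  interpret F: group "free_group X" by (rule group_free_group)
  define \<theta> where "\<theta> = word_val (form_ext \<omega>) (\<lambda>x. (0, e x))"
  have e: "e x \<in> carrier G" for x using fp(4) by blast
  have rng: "range (\<lambda>x. (0, e x)) \<subseteq> carrier (form_ext \<omega>)"
    using e by (auto simp: form_ext_carrier)
  interpret \<theta>: group_hom "free_group X" "form_ext \<omega>" \<theta>
    using E.word_val_hom[OF rng] by (simp add: group_hom_def group_hom_axioms_def E.is_group F.is_group \<theta>_def)
  have snd_\<theta>: "snd (\<theta> w) = word_val G e w" for w
    using E.word_val_hom_comp[OF snd_form_ext_hom G.is_group rng] by (simp add: \<theta>_def o_def)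
  define \<T> :: "((_ \<times> 'i \<Rightarrow> complex) \<Rightarrow> (_ \<times> 'i \<Rightarrow> complex)) set" where
    "\<T> = shift ` (h ` range e \<union> (\<lambda>s. inv\<^bsub>Q\<^esub> h s) ` range e)"
  define M where "M = funs.op_span \<T> ((\<lambda>r. fst (\<theta> r)) ` R)"
  have M: "funs.op_closed \<T> M" by (simp add: M_def funs.op_closed_op_span)
  note subM = funs.op_closedD(1)[OF M]
  define V :: "(_ \<times> 'i \<Rightarrow> complex) set" where "V = {m. \<forall>q i. q \<notin> carrier Q \<longrightarrow> m (q, i) = 0}"
  have "M \<subseteq> V"
    unfolding M_def
  proof (rule funs.op_span_minimal)
    show "funs.op_closed \<T> V"
      by (rule funs.op_closedI) (auto simp: V_def \<T>_def shift_supp fscale_apply funs.subspace_def)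
    show "(\<lambda>r. fst (\<theta> r)) ` R \<subseteq> V"
    proof clarify
      fix r assume "r \<in> R"
      then have "\<theta> r \<in> carrier (form_ext \<omega>)" using fp(3) by auto
      then show "fst (\<theta> r) \<in> V" by (cases "\<theta> r") (simp add: form_ext_carrier V_def)
    qed
  qed
  then have M_supp: "q \<notin> carrier Q \<Longrightarrow> m (q, i) = 0" if "m \<in> M" for m q i
    using that by (auto simp: V_def)
  have shift_M: "shift (h g) m \<in> M" if "g \<in> carrier G" "m \<in> M" for g m
  proof -
    have gen: "shift (h s) \<in> \<T>" "shift (inv\<^bsub>Q\<^esub> h s) \<in> \<T>" "s \<in> carrier G" if "s \<in> range e" for s
      using that e unfolding \<T>_def by blast+
    have "g \<in> generate G (range e)" using that fp(7) by simp
    then have "\<forall>m\<in>M. shift (h g) m \<in> M"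
    proof induction
      case one
      then show ?case by (simp add: shift_one M_supp)
    next
      case (incl s)
      then show ?case using funs.op_closedD(2)[OF M gen(1)] by blast
    next
      case (inv s)
      then show ?case using funs.op_closedD(2)[OF M gen(2)] gen(3) by simp
    next
      case (eng x y)
      then have "x \<in> carrier G" "y \<in> carrier G" using fp(7) by blast+
      then have "shift (h (x \<otimes> y)) m = shift (h x) (shift (h y) m)" for m :: "_ \<times> 'i \<Rightarrow> complex"
        by (simp add: shift_shift)
      then show ?case using eng.IH by simp
    qed
    then show ?thesis using that by blast
  qed
  define N where "N = {w \<in> carrier (free_group X). \<exists>m\<in>M. \<theta> w = (m, \<one>)}"
  have ME: "(m, \<one>) \<in> carrier (form_ext \<omega>)" if "m \<in> M" for m
    using that M_supp by (auto simp: form_ext_carrier)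
  have N_mult: "(m, \<one>) \<otimes>\<^bsub>form_ext \<omega>\<^esub> (m', \<one>) = (m + m', \<one>)" if "m \<in> M" "m' \<in> M" for m m'
    using that by (simp add: form_ext_mult shift_one M_supp form_cocycle_one)
  have "N \<lhd> free_group X"
  proof (rule F.normal_invI)
    show "subgroup N (free_group X)"
    proof (rule F.subgroupI)
      show "N \<subseteq> carrier (free_group X)" by (auto simp: N_def)
      have "\<one>\<^bsub>free_group X\<^esub> \<in> N"
        using \<theta>.hom_one funs.subspace_0[OF subM] by (auto simp: N_def form_ext_one)
      then show "N \<noteq> {}" by blast
      fix u v assume "u \<in> N" "v \<in> N"
      then obtain m m' where uv: "u \<in> carrier (free_group X)" "v \<in> carrier (free_group X)"
        "m \<in> M" "m' \<in> M" "\<theta> u = (m, \<one>)" "\<theta> v = (m', \<one>)" by (auto simp: N_def)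
      then show "u \<otimes>\<^bsub>free_group X\<^esub> v \<in> N"
        using funs.subspace_add[OF subM] by (auto simp: N_def N_mult)
      have neg: "- m \<in> M" using funs.subspace_neg[OF subM uv(3)] .
      then have "(- m, \<one>) \<otimes>\<^bsub>form_ext \<omega>\<^esub> (m, \<one>) = \<one>\<^bsub>form_ext \<omega>\<^esub>"
        using uv by (simp add: N_mult form_ext_one)
      then have "inv\<^bsub>form_ext \<omega>\<^esub> (m, \<one>) = (- m, \<one>)"
        using ME uv(3) neg by (intro E.inv_equality) auto
      then show "inv\<^bsub>free_group X\<^esub> u \<in> N" using uv neg by (auto simp: N_def)
    qed
    show "x \<otimes>\<^bsub>free_group X\<^esub> n \<otimes>\<^bsub>free_group X\<^esub> inv\<^bsub>free_group X\<^esub> x \<in> N"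
      if x: "x \<in> carrier (free_group X)" and n: "n \<in> N" for x n
    proof -
      obtain m where m: "n \<in> carrier (free_group X)" "m \<in> M" "\<theta> n = (m, \<one>)"
        using n by (auto simp: N_def)
      obtain k g where kg: "\<theta> x = (k, g)" by fastforce
      have "(k, g) \<in> carrier (form_ext \<omega>)" using \<theta>.hom_closed[OF x] kg by simp
      moreover from this have "g \<in> carrier G" by (simp add: form_ext_carrier)
      ultimately have "\<theta> (x \<otimes>\<^bsub>free_group X\<^esub> n \<otimes>\<^bsub>free_group X\<^esub> inv\<^bsub>free_group X\<^esub> x) = (shift (h g) m, \<one>)"
        using x m ME by (simp add: kg form_ext_conj)
      then show ?thesis using shift_M \<open>g \<in> carrier G\<close> m x by (auto simp: N_def)
    qed
  qed
  moreover have "R \<subseteq> N"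
  proof
    fix r assume r: "r \<in> R"
    then have "\<theta> r = (fst (\<theta> r), \<one>)" using rel[OF r] snd_\<theta>[of r] by (metis prod.collapse)
    moreover have "fst (\<theta> r) \<in> M" using funs.op_span_superset r by (force simp: M_def)
    ultimately show "r \<in> N" using r fp(3) by (auto simp: N_def)
  qed
  ultimately have kerN: "w \<in> N" if "w \<in> carrier (free_group X)" "word_val G e w = \<one>" for w
    using ker that by blast
  define c :: "_ \<Rightarrow> _ \<Rightarrow> (_ \<times> 'i \<Rightarrow> complex)" where
    "c a b = (\<lambda>(q, i). if q \<in> carrier Q then (\<omega> a b - \<omega> b a) i else 0)" for a b
  have c_in_M: "c a b \<in> M" if ab: "a \<in> A" "b \<in> A" for a b
  proof -
    have "a \<in> word_val G e ` carrier (free_group X)" "b \<in> word_val G e ` carrier (free_group X)"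
      using ab A_carrier fp(6) by simp_all
    then obtain u v where uv: "u \<in> carrier (free_group X)" "v \<in> carrier (free_group X)"
      "word_val G e u = a" "word_val G e v = b"
      by blast
    define w where "w = u \<otimes>\<^bsub>free_group X\<^esub> v \<otimes>\<^bsub>free_group X\<^esub> inv\<^bsub>free_group X\<^esub> (v \<otimes>\<^bsub>free_group X\<^esub> u)"
    obtain m n where mn: "\<theta> u = (m, a)" "\<theta> v = (n, b)"
      using snd_\<theta> uv by (metis prod.collapse)
    have "(m, a) \<in> carrier (form_ext \<omega>)" "(n, b) \<in> carrier (form_ext \<omega>)"
      using \<theta>.hom_closed[of u] \<theta>.hom_closed[of v] uv mn by auto
    then have "\<theta> w = (c a b, \<one>)"
      using uv ab mn by (simp add: w_def form_ext_commutator c_def)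
    moreover from this have "w \<in> N"
      using snd_\<theta>[of w] uv by (intro kerN) (auto simp: w_def)
    ultimately show ?thesis by (auto simp: N_def)
  qed
  define U where "U = {c a b | a b. a \<in> A \<and> b \<in> A}"
  have "\<exists>B. finite B \<and> U \<subseteq> funs.span B"
  proof (rule funs.fixed_vectors_finite_dim)
    show "finite \<T>" "finite ((\<lambda>r. fst (\<theta> r)) ` R)" using fp by (simp_all add: \<T>_def)
    show "Modules.module_hom fscale fscale T" if "T \<in> \<T>" for T
      using that shift_hom by (auto simp: \<T>_def)
    show "U \<subseteq> funs.op_span \<T> ((\<lambda>r. fst (\<theta> r)) ` R)"
      using c_in_M by (auto simp: U_def M_def)
    have T: "\<exists>u\<in>carrier Q. T = shift u" if "T \<in> \<T>" for T
      using that e by (auto simp: \<T>_def)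
    show "T (T' v) = T' (T v)" if "T \<in> \<T>" "T' \<in> \<T>" for T T' v
      using T[OF that(1)] T[OF that(2)] by (auto simp: shift_shift Q.m_comm)
    show "T v = v" if "T \<in> \<T>" "v \<in> U" for T v
      using T[OF that(1)] that(2) by (auto simp: U_def c_def shift_def fun_eq_iff)
  qed
  then obtain B where B: "finite B" "U \<subseteq> funs.span B" by blast
  define ev :: "(_ \<times> 'i \<Rightarrow> complex) \<Rightarrow> 'i \<Rightarrow> complex" where "ev m = (\<lambda>i. m (\<one>\<^bsub>Q\<^esub>, i))" for m
  have ev: "Modules.module_hom fscale fscale ev"
    unfolding ev_def by unfold_locales (auto simp: fun_eq_iff fscale_apply)
  have "\<omega> a b - \<omega> b a \<in> funs.span (ev ` B)" if "a \<in> A" "b \<in> A" for a b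
  proof -
    have "c a b \<in> funs.span B" using B that by (auto simp: U_def)
    then have "ev (c a b) \<in> funs.span (ev ` B)"
      using Modules.module_hom.span_image[OF ev] by blast
    moreover have "ev (c a b) = \<omega> a b - \<omega> b a" by (auto simp: ev_def c_def fun_eq_iff)
    ultimately show ?thesis by simp
  qed
  then show ?thesis using B(1) by blast
qed

end

end

section \<open>Eigenfunctionals on the abelian kernel\<close>

lemma norm_eq_1_cnj: "norm z = 1 \<Longrightarrow> z * cnj z = 1"
  by (simp add: complex_norm_square[symmetric])

lemma (in group) inv_cancel:
  assumes "x \<in> carrier G" "y \<in> carrier G"
  shows "x \<otimes> (inv x \<otimes> y) = y" "inv x \<otimes> (x \<otimes> y) = y"
  using assms by (simp_all add: m_assoc[symmetric])

context abelian_by_abelian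
begin

text \<open>The additive functions from \<open>A\<close> to the complex numbers, extended by zero.\<close>

definition functionals :: "(_ \<Rightarrow> complex) set" where
  "functionals = {f. (\<forall>a\<in>A. \<forall>b\<in>A. f (a \<otimes> b) = f a + f b) \<and> (\<forall>a. a \<notin> A \<longrightarrow> f a = 0)}"

text \<open>
  The action of \<open>G\<close> on functions on \<open>A\<close> through conjugation. It factors through \<open>Q\<close>, whence the
  operators commute.
\<close>

definition conj_op :: "_ \<Rightarrow> (_ \<Rightarrow> complex) \<Rightarrow> (_ \<Rightarrow> complex)" where
  "conj_op g f = (\<lambda>a. if a \<in> A then f (g \<otimes> a \<otimes> inv g) else 0)"

lemma subspace_functionals: "funs.subspace functionals"
  by (auto simp: functionals_def fscale_apply funs.subspace_def algebra_simps)

lemma conj_op_hom: "Modules.module_hom fscale fscale (conj_op g)"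
  unfolding conj_op_def by unfold_locales (auto simp: fscale_apply fun_eq_iff algebra_simps)

lemma conj_mult:
  assumes "g \<in> carrier G" "a \<in> A" "b \<in> A"
  shows "g \<otimes> (a \<otimes> b) \<otimes> inv g = (g \<otimes> a \<otimes> inv g) \<otimes> (g \<otimes> b \<otimes> inv g)"
  using assms by (simp add: A_carrier G.m_assoc G.inv_cancel)

lemma conj_op_closed:
  assumes "g \<in> carrier G" "f \<in> functionals"
  shows "conj_op g f \<in> functionals"
  using assms by (auto simp: functionals_def conj_op_def conj_mult)

lemma conj_eq:
  assumes "x \<in> carrier G" "y \<in> carrier G" "h x = h y" "a \<in> A"
  shows "x \<otimes> a \<otimes> inv x = y \<otimes> a \<otimes> inv y"
proof -
  define d where "d = inv y \<otimes> x"
  have d: "d \<in> A" using assms by (simp add: d_def kernel_def)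
  have x: "x = y \<otimes> d" using assms by (simp add: d_def G.m_assoc[symmetric])
  have "d \<otimes> a \<otimes> inv d = a"
    using kernel_comm[OF d assms(4)] d assms(4) by (simp add: A_carrier G.m_assoc)
  moreover have "x \<otimes> a \<otimes> inv x = y \<otimes> (d \<otimes> a \<otimes> inv d) \<otimes> inv y"
    using assms d by (simp add: x A_carrier G.m_assoc G.inv_mult_group)
  ultimately show ?thesis by simp
qed

lemma conj_op_conj_op:
  assumes "g \<in> carrier G" "g' \<in> carrier G"
  shows "conj_op g (conj_op g' f) = conj_op (g' \<otimes> g) f"
proof -
  have "g' \<otimes> (g \<otimes> a \<otimes> inv g) \<otimes> inv g' = (g' \<otimes> g) \<otimes> a \<otimes> inv (g' \<otimes> g)" if "a \<in> A" for a
    using assms that by (simp add: A_carrier G.m_assoc G.inv_mult_group)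
  then show ?thesis using assms by (auto simp: conj_op_def fun_eq_iff)
qed

lemma conj_op_cong:
  assumes "x \<in> carrier G" "y \<in> carrier G" "h x = h y"
  shows "conj_op x f = conj_op y f"
  using conj_eq[OF assms] by (auto simp: conj_op_def fun_eq_iff)

lemma conj_op_comm:
  assumes "g \<in> carrier G" "g' \<in> carrier G"
  shows "conj_op g (conj_op g' f) = conj_op g' (conj_op g f)"
  using assms by (simp add: conj_op_conj_op) (intro conj_op_cong; simp add: Q.m_comm)

lemma conj_op_pow_comm:
  assumes "g \<in> carrier G" "g' \<in> carrier G"
  shows "conj_op g ((conj_op g' ^^ n) f) = (conj_op g' ^^ n) (conj_op g f)"
  by (induction n) (simp_all add: conj_op_comm[OF assms])

text \<open>
  The functionals on which each \<open>g\<close> in \<open>\<Gamma>\<close> acts by the scalar \<open>z g\<close>. When \<open>\<Gamma>\<close> generates \<open>G\<close>, the tuple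
  \<open>z\<close> of scalars stands for a character.
\<close>

definition eigenspace :: "_ set \<Rightarrow> (_ \<Rightarrow> complex) \<Rightarrow> (_ \<Rightarrow> complex) set" where
  "eigenspace \<Gamma> z = {f \<in> functionals. \<forall>g\<in>\<Gamma>. conj_op g f = fscale (z g) f}"

lemma subspace_eigenspace: "funs.subspace (eigenspace \<Gamma> z)"
  unfolding eigenspace_def
  by (rule funs.subspaceI)
     (auto simp: funs.subspace_0[OF subspace_functionals] funs.subspace_add[OF subspace_functionals]
       funs.subspace_scale[OF subspace_functionals] Modules.module_hom.add[OF conj_op_hom]
       Modules.module_hom.zero[OF conj_op_hom] Modules.module_hom.scale[OF conj_op_hom]
       funs.scale_right_distrib mult.commute)

lemma eigenspaces_independent:
  assumes "finite J" "\<And>j k. j \<in> J \<Longrightarrow> k \<in> J \<Longrightarrow> j \<noteq> k \<Longrightarrow> \<exists>g\<in>\<Gamma>. z j g \<noteq> z k g"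
    and "\<And>j. j \<in> J \<Longrightarrow> f j \<in> eigenspace \<Gamma> (z j)" "(\<Sum>j\<in>J. f j) = 0" "j \<in> J"
  shows "f j = 0"
  using assms
proof (induction J arbitrary: f j)
  case (insert k J)
  have zero: "f j = 0" if j: "j \<in> J" for j
  proof -
    have "j \<noteq> k" using j insert.hyps by blast
    then obtain g where g: "g \<in> \<Gamma>" "z j g \<noteq> z k g" using insert.prems(1)[of j k] j by auto
    have eig: "conj_op g (f i) = fscale (z i g) (f i)" if "i \<in> insert k J" for i
      using insert.prems(2)[OF that] g(1) by (simp add: eigenspace_def)
    have "fscale (z j g - z k g) (f j) = 0"
    proof (rule insert.IH[of "\<lambda>i. fscale (z i g - z k g) (f i)" j])
      have "(\<Sum>i\<in>insert k J. fscale (z i g - z k g) (f i))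
        = (\<Sum>i\<in>insert k J. conj_op g (f i) - fscale (z k g) (f i))"
        by (rule sum.cong) (simp_all add: eig funs.scale_left_diff_distrib)
      also have "\<dots> = conj_op g (\<Sum>i\<in>insert k J. f i) - fscale (z k g) (\<Sum>i\<in>insert k J. f i)"
        by (simp only: Modules.module_hom.sum[OF conj_op_hom] funs.scale_sum_right sum_subtractf)
      also have "\<dots> = 0"
        unfolding insert.prems(3) by (simp only: Modules.module_hom.zero[OF conj_op_hom]
            funs.scale_zero_right diff_zero)
      finally show "(\<Sum>i\<in>J. fscale (z i g - z k g) (f i)) = 0"
        unfolding sum.insert[OF insert.hyps(1,2)] by (simp only: diff_self funs.scale_zero_left add_0)
      show "fscale (z i g - z k g) (f i) \<in> eigenspace \<Gamma> (z i)" if "i \<in> J" for i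
        using that by (intro funs.subspace_scale[OF subspace_eigenspace] insert.prems(2)) simp
    qed (use insert.prems(1) j in auto)
    then show ?thesis using g(2) by (simp add: fscale_apply fun_eq_iff)
  qed
  then have "sum f J = 0" by (intro sum.neutral ballI)
  then have "f k = 0"
    using insert.prems(3) unfolding sum.insert[OF insert.hyps(1,2)] by (simp only: add_0_right)
  then show ?case using zero insert.prems(4) by blast
qed simp

lemma cnj_eigenspace:
  assumes "f \<in> eigenspace \<Gamma> z"
  shows "(\<lambda>a. cnj (f a)) \<in> eigenspace \<Gamma> (\<lambda>g. cnj (z g))"
  using assms by (auto simp: eigenspace_def functionals_def conj_op_def fun_eq_iff fscale_apply split: if_splits)

text \<open>
  The products \<open>f i a * k i b\<close> are the components of an invariant form with values in the sequences.
  Their antisymmetrisations satisfy a linear relation by \<open>form_commutators_finite_dim\<close>; with \<open>b\<close>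
  fixed it becomes a relation between the functionals \<open>f i\<close> and \<open>k i\<close>.
\<close>

lemma no_independent_invariant_products:
  fixes f k :: "nat \<Rightarrow> _ \<Rightarrow> complex"
  assumes fp: "finitely_presented G"
    and f: "\<And>i. f i \<in> functionals" and k: "\<And>i. k i \<in> functionals" "\<And>i. k i \<noteq> 0"
    and inv: "\<And>i g a b. g \<in> carrier G \<Longrightarrow> a \<in> A \<Longrightarrow> b \<in> A \<Longrightarrow>
      f i (g \<otimes> a \<otimes> inv g) * k i (g \<otimes> b \<otimes> inv g) = f i a * k i b"
    and indep: "\<And>I c d i. finite I \<Longrightarrow> (\<Sum>i\<in>I. fscale (c i) (f i) + fscale (d i) (k i)) = 0 \<Longrightarrow>
      i \<in> I \<Longrightarrow> c i = 0"
  shows False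
proof -
  define \<omega> where "\<omega> a b = (\<lambda>i. f i a * k i b)" for a b
  have inv_form: "invariant_form \<omega>"
    using f k(1) inv by (auto simp: invariant_form_def \<omega>_def fun_eq_iff functionals_def algebra_simps)
  obtain B where B: "finite B" "\<And>a b. a \<in> A \<Longrightarrow> b \<in> A \<Longrightarrow> \<omega> a b - \<omega> b a \<in> funs.span B"
    using form_commutators_finite_dim[OF inv_form fp] by (elim exE conjE) simp
  \<comment> \<open>More than \<open>card B\<close> coordinates of the sequences in \<open>B\<close> are linearly dependent.\<close>
  define v where "v i = (\<lambda>w. if w \<in> B then w i else 0)" for i :: nat
  define \<delta> where "\<delta> w = (\<lambda>w'. if w' = w then 1 else 0 :: complex)" for w :: "nat \<Rightarrow> complex"
  have "v i = (\<Sum>w\<in>B. fscale (w i) (\<delta> w))" for i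
    by (rule ext) (use B(1) in \<open>simp add: fscale_apply v_def \<delta>_def sum_fun_apply if_distrib cong: if_cong\<close>)
  then have "v i \<in> funs.span (\<delta> ` B)" for i
    by (auto intro!: funs.span_sum funs.span_scale intro: funs.span_base)
  moreover have "card (\<delta> ` B) < card {..card B}"
    using card_image_le[OF B(1), of \<delta>] by simp
  ultimately obtain c where c: "\<exists>i\<in>{..card B}. c i \<noteq> 0" "(\<Sum>i\<le>card B. fscale (c i) (v i)) = 0"
    using funs.many_vectors_dependent[of "\<delta> ` B" "{..card B}" v] B(1) by auto
  have "(\<Sum>i\<le>card B. c i * w i) = 0" if "w \<in> funs.span B" for w
  proof -
    have "(\<Sum>i\<le>card B. c i * w i) = 0" if "w \<in> B" for w
      using fun_cong[OF c(2), of w] that by (simp add: fscale_apply sum_fun_apply v_def)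
    then have "B \<subseteq> {w. (\<Sum>i\<le>card B. c i * w i) = 0}" by blast
    moreover have "funs.subspace {w. (\<Sum>i\<le>card B. c i * w i) = 0}"
      by (rule funs.subspaceI)
        (simp_all add: distrib_left sum.distrib fscale_apply mult.left_commute flip: sum_distrib_left)
    ultimately show ?thesis using funs.span_minimal that by blast
  qed
  from this[OF B(2)]
  have rel: "(\<Sum>i\<le>card B. c i * (f i a * k i b - f i b * k i a)) = 0" if "a \<in> A" "b \<in> A" for a b
    using that by (simp add: \<omega>_def)
  obtain i where i: "i \<le> card B" "c i \<noteq> 0" using c(1) by auto
  have "k i b = 0" for b
  proof (cases "b \<in> A")
    case True
    have "(\<Sum>i\<le>card B. fscale (c i * k i b) (f i) + fscale (- c i * f i b) (k i)) = 0"
    proof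
      fix a show "(\<Sum>i\<le>card B. fscale (c i * k i b) (f i) + fscale (- c i * f i b) (k i)) a = 0 a"
      proof (cases "a \<in> A")
        case True
        show ?thesis using rel[OF True \<open>b \<in> A\<close>] by (simp add: fscale_apply sum_fun_apply algebra_simps)
      next
        case False
        then have "f i a = 0" "k i a = 0" for i using f k by (auto simp: functionals_def)
        then show ?thesis by (simp add: fscale_apply sum_fun_apply)
      qed
    qed
    then have "c i * k i b = 0"
      by (rule indep[of "{..card B}" "\<lambda>i. c i * k i b" "\<lambda>i. - c i * f i b", rotated]) (use i in auto)
    then show ?thesis using i by simp
  next
    case False
    then show ?thesis using k(1)[of i] by (simp add: functionals_def)
  qed
  then show False using k(2)[of i] by (simp add: fscale_apply fun_eq_iff)
qed

context
  fixes \<Gamma>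
  assumes fp: "finitely_presented G" and \<Gamma>: "finite \<Gamma>" "carrier G = generate G \<Gamma>"
begin

lemma \<Gamma>_carrier: "\<Gamma> \<subseteq> carrier G"
  using \<Gamma>(2) by (auto intro: generate.incl)

lemma eigen_product_invariant:
  assumes f: "f \<in> eigenspace \<Gamma> z" and k: "k \<in> eigenspace \<Gamma> z'"
    and zz: "\<And>g. g \<in> \<Gamma> \<Longrightarrow> z g * z' g = 1"
    and g: "g \<in> carrier G" and ab: "a \<in> A" "b \<in> A"
  shows "f (g \<otimes> a \<otimes> inv g) * k (g \<otimes> b \<otimes> inv g) = f a * k b"
proof -
  have step: "f (s \<otimes> a \<otimes> inv s) * k (s \<otimes> b \<otimes> inv s) = f a * k b"
    if "s \<in> \<Gamma>" "a \<in> A" "b \<in> A" for s a b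
  proof -
    have "conj_op s f a = fscale (z s) f a" "conj_op s k b = fscale (z' s) k b"
      using f k that(1) by (simp_all add: eigenspace_def)
    then have "f (s \<otimes> a \<otimes> inv s) = z s * f a" "k (s \<otimes> b \<otimes> inv s) = z' s * k b"
      using that(2,3) by (simp_all add: fscale_apply conj_op_def)
    then have "f (s \<otimes> a \<otimes> inv s) * k (s \<otimes> b \<otimes> inv s) = (z s * z' s) * (f a * k b)" by simp
    then show ?thesis using zz[OF that(1)] by simp
  qed
  have step': "f (inv s \<otimes> a \<otimes> s) * k (inv s \<otimes> b \<otimes> s) = f a * k b"
    if s: "s \<in> \<Gamma>" and ab: "a \<in> A" "b \<in> A" for s a b
  proof -
    have "s \<in> carrier G" using s \<Gamma>_carrier by blast
    then have "s \<otimes> (inv s \<otimes> c \<otimes> s) \<otimes> inv s = c" "inv s \<otimes> c \<otimes> s \<in> A" if "c \<in> A" for c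
      using that by (simp_all add: A_carrier G.m_assoc G.inv_cancel del: A_conj') (metis A_carrier A_conj' G.inv_closed G.m_assoc)
    then show ?thesis using step[OF s, of "inv s \<otimes> a \<otimes> s" "inv s \<otimes> b \<otimes> s"] ab by simp
  qed
  have "g \<in> generate G \<Gamma>" using g \<Gamma> by simp
  then have "\<forall>a\<in>A. \<forall>b\<in>A. f (g \<otimes> a \<otimes> inv g) * k (g \<otimes> b \<otimes> inv g) = f a * k b"
  proof induction
    case (inv s)
    then have "s \<in> carrier G" using \<Gamma>_carrier by blast
    then show ?case using step'[OF inv] by simp
  next
    case (eng x y)
    then have "x \<in> carrier G" "y \<in> carrier G" using \<Gamma>(2) by blast+
    then have "(x \<otimes> y) \<otimes> a \<otimes> inv (x \<otimes> y) = x \<otimes> (y \<otimes> a \<otimes> inv y) \<otimes> inv x" "y \<otimes> a \<otimes> inv y \<in> A"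
      if "a \<in> A" for a
      using that by (simp_all add: A_carrier G.m_assoc G.inv_mult_group del: A_conj)
        (metis A_conj G.m_assoc A_carrier G.inv_closed)
    then show ?case using eng.IH by simp
  qed (simp_all add: A_carrier step)
  then show ?thesis using ab by blast
qed

text \<open>
  An infinite independent family in the eigenspace is paired with one fixed functional \<open>k\<close> of the
  inverse character. For a real character \<open>k\<close> lies in the same eigenspace, so the family is chosen
  independent of \<open>k\<close>.
\<close>

lemma eigenspace_finite_dim:
  assumes z: "\<And>g. g \<in> \<Gamma> \<Longrightarrow> norm (z g) = 1"
  shows "\<exists>B. finite B \<and> eigenspace \<Gamma> z \<subseteq> funs.span B"
proof (rule ccontr)
  assume no: "\<not> ?thesis"
  then obtain f0 where f0: "f0 \<in> eigenspace \<Gamma> z" "f0 \<noteq> 0"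
    using funs.span_zero by (metis finite.emptyI subsetI)
  define k where "k = (\<lambda>a. cnj (f0 a))"
  have k: "k \<in> eigenspace \<Gamma> (\<lambda>g. cnj (z g))" unfolding k_def by (rule cnj_eigenspace[OF f0(1)])
  have k0: "k \<noteq> 0" using f0(2) by (auto simp: k_def fun_eq_iff)
  have "funs.independent {k}" using k0 by (simp add: funs.dependent_single)
  then obtain B where B: "{k} \<subseteq> B" "B \<subseteq> insert k (eigenspace \<Gamma> z)" "funs.independent B"
    "insert k (eigenspace \<Gamma> z) \<subseteq> funs.span B"
    using funs.maximal_independent_subset_extend[of "{k}" "insert k (eigenspace \<Gamma> z)"] by blast
  have "infinite B" using no B(4) by blast
  then have "infinite (B - {k})" by simp
  then obtain f :: "nat \<Rightarrow> _" where f: "inj f" "range f \<subseteq> B - {k}"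
    using infinite_countable_subset by blast
  have fE: "f i \<in> eigenspace \<Gamma> z" for i using f(2) B(2) by blast
  show False
  proof (rule no_independent_invariant_products[OF fp, of f "\<lambda>_. k"])
    show "f i (g \<otimes> a \<otimes> inv g) * k (g \<otimes> b \<otimes> inv g) = f i a * k b"
      if "g \<in> carrier G" "a \<in> A" "b \<in> A" for i g a b
      using eigen_product_invariant[OF fE k _ that] z norm_eq_1_cnj by blast
    fix I c d i assume I: "finite I" and i: "i \<in> I"
      and rel: "(\<Sum>i\<in>I. fscale (c i) (f i) + fscale (d i) k) = 0"
    define u where "u w = (if w = k then \<Sum>i\<in>I. d i else c (inv_into UNIV f w))" for w
    have fk: "f j \<noteq> k" for j using f(2) by blast
    have "(\<Sum>w\<in>insert k (f ` I). fscale (u w) w) = fscale (u k) k + (\<Sum>j\<in>I. fscale (u (f j)) (f j))"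
      using I fk by (subst sum.insert) (auto simp: sum.reindex[OF inj_on_subset[OF f(1)]])
    also have "\<dots> = 0"
      using rel f(1) by (simp add: u_def fk sum.distrib funs.scale_sum_left add.commute)
    finally have "u (f i) = 0"
      using I i f(2) B(1) by (intro funs.independentD[OF B(3), of "insert k (f ` I)"]) auto
    then show "c i = 0" using f(1) fk by (simp add: u_def)
  qed (use fE k k0 in \<open>auto simp: eigenspace_def\<close>)
qed

text \<open>
  The condition on the sign of the imaginary part of one eigenvalue ensures that no two of the
  characters considered are inverse to each other.
\<close>

lemma finite_eigenvalues_half:
  assumes g: "g \<in> \<Gamma>"
  shows "finite {z. (\<forall>g. g \<notin> \<Gamma> \<longrightarrow> z g = 0) \<and> (\<forall>g\<in>\<Gamma>. norm (z g) = 1) \<and>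
    eigenspace \<Gamma> z \<noteq> {0} \<and> s * Im (z g) > 0}" (is "finite ?Y")
proof (rule ccontr)
  assume "infinite ?Y"
  then obtain z :: "nat \<Rightarrow> _" where z: "inj z" "range z \<subseteq> ?Y"
    using infinite_countable_subset by blast
  have zY: "z i \<in> ?Y" for i using z(2) by blast
  have "\<exists>f. f \<in> eigenspace \<Gamma> (z i) \<and> f \<noteq> 0" for i
    using zY[of i] funs.subspace_0[OF subspace_eigenspace] by blast
  then obtain f where f: "\<And>i. f i \<in> eigenspace \<Gamma> (z i)" "\<And>i. f i \<noteq> 0" by metis
  define k where "k i = (\<lambda>a. cnj (f i a))" for i
  have k: "k i \<in> eigenspace \<Gamma> (\<lambda>g. cnj (z i g))" for i
    unfolding k_def by (rule cnj_eigenspace[OF f(1)])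
  show False
  proof (rule no_independent_invariant_products[OF fp, of f k])
    show "k i \<noteq> 0" for i using f(2)[of i] by (auto simp: k_def fun_eq_iff)
    show "f i (g \<otimes> a \<otimes> inv g) * k i (g \<otimes> b \<otimes> inv g) = f i a * k i b"
      if "g \<in> carrier G" "a \<in> A" "b \<in> A" for i g a b
      using eigen_product_invariant[OF f(1) k _ that] zY norm_eq_1_cnj by blast
    fix I c d i assume I: "finite I" and i: "i \<in> I"
      and rel: "(\<Sum>i\<in>I. fscale (c i) (f i) + fscale (d i) (k i)) = 0"
    define \<zeta> where "\<zeta> = (\<lambda>(i, b). if b then z i else (\<lambda>g. cnj (z i g)))"
    define F where "F = (\<lambda>(i, b). if b then fscale (c i) (f i) else fscale (d i) (k i))"
    have diff: "\<exists>g\<in>\<Gamma>. z i g \<noteq> z j g" if "i \<noteq> j" for i j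
    proof -
      have "z i \<noteq> z j" using z(1) that by (auto dest: injD)
      then obtain g where "z i g \<noteq> z j g" by blast
      then show ?thesis using zY[of i] zY[of j] by (cases "g \<in> \<Gamma>") auto
    qed
    have Im: "s * Im (z i g) > 0" for i using zY by blast
    have "F (i, True) = 0"
    proof (rule eigenspaces_independent[where J = "I \<times> UNIV" and \<Gamma> = "\<Gamma>" and z = \<zeta>])
      show "(\<Sum>j\<in>I \<times> UNIV. F j) = 0"
        using rel by (simp add: sum.cartesian_product[symmetric] UNIV_bool F_def add.commute)
      show "F j \<in> eigenspace \<Gamma> (\<zeta> j)" for j
        using f(1) k funs.subspace_scale[OF subspace_eigenspace]
        by (cases j) (auto simp: F_def \<zeta>_def)
      show "\<exists>g\<in>\<Gamma>. \<zeta> j g \<noteq> \<zeta> l g" if "j \<noteq> l" for j l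
      proof -
        obtain i b i' b' where jl: "j = (i, b)" "l = (i', b')" by fastforce
        show ?thesis
        proof (cases "b = b'")
          case True
          then show ?thesis using diff[of i i'] that jl by (auto simp: \<zeta>_def)
        next
          case False
          then have "Im (\<zeta> j g) \<noteq> Im (\<zeta> l g)"
            using Im[of i] Im[of i'] by (auto simp: \<zeta>_def jl zero_less_mult_iff)
          then show ?thesis using g by metis
        qed
      qed
    qed (use I i in auto)
    then have "fscale (c i) (f i) = 0" by (simp add: F_def)
    then show "c i = 0" using f(2)[of i] by (simp add: funs.scale_eq_0_iff)
  qed (use f k in \<open>auto simp: eigenspace_def\<close>)
qed

lemma finite_eigenvalues:
  "finite {z. (\<forall>g. g \<notin> \<Gamma> \<longrightarrow> z g = 0) \<and> (\<forall>g\<in>\<Gamma>. norm (z g) = 1) \<and>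
    eigenspace \<Gamma> z \<noteq> {0}}" (is "finite ?X")
proof -
  let ?Y = "\<lambda>g s. {z. (\<forall>g. g \<notin> \<Gamma> \<longrightarrow> z g = 0) \<and> (\<forall>g\<in>\<Gamma>. norm (z g) = 1) \<and>
    eigenspace \<Gamma> z \<noteq> {0} \<and> s * Im (z g) > 0}"
  let ?R = "{z. \<forall>g. (g \<in> \<Gamma> \<longrightarrow> z g \<in> {1, -1 :: complex}) \<and> (g \<notin> \<Gamma> \<longrightarrow> z g = 0)}"
  have "?X \<subseteq> ?R \<union> (\<Union>g\<in>\<Gamma>. ?Y g 1 \<union> ?Y g (-1))"
  proof
    fix z assume z: "z \<in> ?X"
    show "z \<in> ?R \<union> (\<Union>g\<in>\<Gamma>. ?Y g 1 \<union> ?Y g (-1))"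
    proof (cases "\<forall>g\<in>\<Gamma>. Im (z g) = 0")
      case True
      have "w \<in> {1, -1}" if "Im w = 0" "norm w = 1" for w
        using that cmod_power2[of w] by (auto simp: complex_eq_iff power2_eq_1_iff)
      then have "z \<in> ?R" using z True by simp
      then show ?thesis by (rule UnI1)
    next
      case False
      then obtain g where "g \<in> \<Gamma>" "Im (z g) \<noteq> 0" by blast
      then have "z \<in> ?Y g 1 \<union> ?Y g (-1)" using z by (simp add: linorder_neq_iff disj_commute)
      then have "z \<in> (\<Union>g\<in>\<Gamma>. ?Y g 1 \<union> ?Y g (-1))" by (rule UN_I[OF \<open>g \<in> \<Gamma>\<close>])
      then show ?thesis by (rule UnI2)
    qed
  qed
  moreover have "finite ?R" using \<Gamma>(1) by (intro finite_set_of_finite_funs) auto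
  moreover have "finite (\<Union>g\<in>\<Gamma>. ?Y g 1 \<union> ?Y g (-1))"
    by (intro finite_UN_I finite_UnI \<Gamma>(1) finite_eigenvalues_half)
  ultimately show ?thesis using finite_subset finite_UnI by blast
qed

lemma eigenspaces_finite_dim:
  "\<exists>B. finite B \<and> (\<forall>z. (\<forall>g\<in>\<Gamma>. norm (z g) = 1) \<longrightarrow> eigenspace \<Gamma> z \<subseteq> funs.span B)"
proof -
  let ?X = "{z. (\<forall>g. g \<notin> \<Gamma> \<longrightarrow> z g = 0) \<and> (\<forall>g\<in>\<Gamma>. norm (z g) = 1) \<and>
    eigenspace \<Gamma> z \<noteq> {0}}"
  have "\<forall>z\<in>?X. \<exists>B. finite B \<and> eigenspace \<Gamma> z \<subseteq> funs.span B"
    by (intro ballI eigenspace_finite_dim) simp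
  then obtain B where B: "\<forall>z\<in>?X. finite (B z) \<and> eigenspace \<Gamma> z \<subseteq> funs.span (B z)"
    by (elim exE[OF bchoice])
  show ?thesis
  proof (intro exI[of _ "\<Union>z\<in>?X. B z"] conjI allI impI)
    show "finite (\<Union>z\<in>?X. B z)" using B by (intro finite_UN_I finite_eigenvalues) simp
    fix z :: "_ \<Rightarrow> complex" assume z: "\<forall>g\<in>\<Gamma>. norm (z g) = 1"
    define z' where "z' g = (if g \<in> \<Gamma> then z g else 0)" for g
    have eq: "eigenspace \<Gamma> z = eigenspace \<Gamma> z'" by (simp add: eigenspace_def z'_def)
    show "eigenspace \<Gamma> z \<subseteq> funs.span (\<Union>z\<in>?X. B z)"
    proof (cases "eigenspace \<Gamma> z' = {0}")
      case True
      then show ?thesis using eq funs.span_zero by simp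
    next
      case False
      then have "z' \<in> ?X" using z by (auto simp: z'_def)
      then have "eigenspace \<Gamma> z' \<subseteq> funs.span (B z')" "B z' \<subseteq> (\<Union>z\<in>?X. B z)"
        using bspec[OF B] by blast+
      then show ?thesis using eq funs.span_mono by blast
    qed
  qed
qed

end

end

section \<open>Functionals that are invariant under powers\<close>

lemma sum_powers_root_of_unity:
  assumes "l < m"
  shows "(\<Sum>j<m. cis (2 * pi / real m) ^ (j * l)) = (if l = 0 then of_nat m else 0)"
proof (cases "l = 0")
  case False
  define c where "c = cis (2 * pi / real m) ^ l"
  have c: "c = cis (2 * pi * real l / real m)" by (simp add: c_def Complex.DeMoivre mult_ac)
  have m: "m > 0" using assms by simp
  have inj: "inj_on (\<lambda>k. cis (2 * pi * real k / real m)) {..<m}"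
    using bij_betw_roots_unity[OF m] by (rule bij_betw_imp_inj_on)
  have "c \<noteq> 1"
    using inj_onD[OF inj, of l 0] assms m False by (auto simp: c)
  moreover have "cis (2 * pi / real m) ^ m = 1"
    using m by (simp add: Complex.DeMoivre)
  then have "c ^ m = 1"
    unfolding c_def power_mult[symmetric] mult.commute[of l m] by (simp add: power_mult)
  ultimately have "(\<Sum>j<m. c ^ j) = 0" by (simp add: geometric_sum)
  then show ?thesis using False by (simp add: c_def power_mult[symmetric] mult.commute)
qed simp

context abelian_by_abelian
begin

text \<open>The functionals on which the generators act with order dividing \<open>m\<close>.\<close>

definition periodic :: "_ set \<Rightarrow> nat \<Rightarrow> (_ \<Rightarrow> complex) set" where
  "periodic \<Gamma> m = {f \<in> functionals. \<forall>g\<in>\<Gamma>. (conj_op g ^^ m) f = f}"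

lemma conj_op_pow_hom: "Modules.module_hom fscale fscale (conj_op g ^^ n)"
  by (induction n) (use conj_op_hom in \<open>auto simp: Modules.module_hom_iff\<close>)

lemma subspace_periodic: "funs.subspace (periodic \<Gamma> m)"
  unfolding periodic_def
  by (rule funs.subspaceI)
     (auto simp: funs.subspace_0[OF subspace_functionals] funs.subspace_add[OF subspace_functionals]
       funs.subspace_scale[OF subspace_functionals] Modules.module_hom.add[OF conj_op_pow_hom]
       Modules.module_hom.zero[OF conj_op_pow_hom] Modules.module_hom.scale[OF conj_op_pow_hom])

lemma periodic_conj_op:
  assumes "\<Gamma> \<subseteq> carrier G" "g \<in> carrier G" "f \<in> periodic \<Gamma> m"
  shows "conj_op g f \<in> periodic \<Gamma> m"
  using assms conj_op_closed[of g f] conj_op_pow_comm[of g _ m f] unfolding periodic_def by fastforce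

text \<open>
  The operators have finite order, hence they are diagonalised one after the other: averaging with
  the powers of a primitive \<open>m\<close>-th root of unity projects onto the eigenspaces of each.
\<close>

lemma periodic_spanned_by_eigenvectors:
  assumes "finite \<Delta>" "\<Delta> \<subseteq> \<Gamma>" "\<Gamma> \<subseteq> carrier G" "m > 0"
  shows "periodic \<Gamma> m \<subseteq>
    funs.span {f \<in> periodic \<Gamma> m. \<forall>g\<in>\<Delta>. \<exists>\<zeta>. norm \<zeta> = 1 \<and> conj_op g f = fscale \<zeta> f}"
  using assms(1,2)
proof (induction \<Delta>)
  case empty
  show ?case by (auto intro: funs.span_base)
next
  case (insert g \<Delta>)
  let ?D = "\<lambda>\<Delta>. {f \<in> periodic \<Gamma> m. \<forall>g\<in>\<Delta>. \<exists>\<zeta>. norm \<zeta> = 1 \<and> conj_op g f = fscale \<zeta> f}"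
  have g: "g \<in> \<Gamma>" "g \<in> carrier G" using insert.prems assms(3) by auto
  have "f \<in> funs.span (?D (insert g \<Delta>))" if f: "f \<in> ?D \<Delta>" for f
  proof -
    define w where "w = cis (2 * pi / real m)"
    define p where "p j = (\<Sum>l<m. fscale (w ^ (j * l)) ((conj_op g ^^ l) f))" for j
    have w: "w ^ m = 1" "norm w = 1" "w \<noteq> 0"
      using assms(4) by (simp_all add: w_def Complex.DeMoivre)
    have pow_per: "(conj_op g ^^ l) f \<in> periodic \<Gamma> m" for l
      using f by (induction l) (auto intro: periodic_conj_op[OF assms(3) g(2)])
    then have p_per: "p j \<in> periodic \<Gamma> m" for j
      unfolding p_def
      by (intro funs.subspace_sum[OF subspace_periodic] funs.subspace_scale[OF subspace_periodic])
    have "(\<Sum>l<m. fscale (w ^ (j * Suc l)) ((conj_op g ^^ Suc l) f)) = p j" for j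
    proof -
      let ?t = "\<lambda>l. fscale (w ^ (j * l)) ((conj_op g ^^ l) f)"
      have "w ^ (j * m) = 1" unfolding mult.commute[of j m] power_mult w(1) by simp
      then have "?t m = ?t 0" using f g by (simp add: periodic_def)
      moreover have "(\<Sum>l<m. ?t (Suc l)) + ?t 0 = (\<Sum>l<m. ?t l) + ?t m"
        using sum.lessThan_Suc[of ?t m] sum.lessThan_Suc_shift[of ?t m] by (simp add: add.commute)
      ultimately show ?thesis unfolding p_def by (simp only: add_right_cancel)
    qed
    moreover have "fscale (w ^ j) (conj_op g (p j))
      = (\<Sum>l<m. fscale (w ^ (j * Suc l)) ((conj_op g ^^ Suc l) f))" for j
      by (simp add: p_def Modules.module_hom.sum[OF conj_op_hom] Modules.module_hom.scale[OF conj_op_hom]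
          funs.scale_sum_right power_add)
    ultimately have shift: "fscale (w ^ j) (conj_op g (p j)) = p j" for j by simp
    have eig_g: "conj_op g (p j) = fscale (inverse (w ^ j)) (p j)" for j
    proof -
      have "fscale (inverse (w ^ j)) (fscale (w ^ j) (conj_op g (p j))) = conj_op g (p j)"
        using w(3) by simp
      then show ?thesis by (simp only: shift)
    qed
    have p_D: "p j \<in> ?D (insert g \<Delta>)" for j
    proof -
      have "\<exists>\<zeta>. norm \<zeta> = 1 \<and> conj_op g' (p j) = fscale \<zeta> (p j)" if g': "g' \<in> \<Delta>" for g'
      proof -
        obtain \<zeta> where \<zeta>: "norm \<zeta> = 1" "conj_op g' f = fscale \<zeta> f" using f g' by blast
        have "g' \<in> carrier G" using g' insert.prems assms(3) by blast
        then have "conj_op g' ((conj_op g ^^ l) f) = fscale \<zeta> ((conj_op g ^^ l) f)" for l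
          using g by (simp add: conj_op_pow_comm \<zeta>(2) Modules.module_hom.scale[OF conj_op_pow_hom])
        then have "conj_op g' (p j) = fscale \<zeta> (p j)"
          by (simp add: p_def Modules.module_hom.sum[OF conj_op_hom] Modules.module_hom.scale[OF conj_op_hom]
              funs.scale_sum_right mult.commute)
        then show ?thesis using \<zeta>(1) by blast
      qed
      moreover have "norm (inverse (w ^ j)) = 1" using w(2) by (simp add: norm_inverse norm_power)
      ultimately show ?thesis using p_per eig_g by blast
    qed
    have f_sum: "f = (\<Sum>j<m. fscale (1 / of_nat m) (p j))"
    proof -
      have "(\<Sum>j<m. p j) = (\<Sum>l<m. \<Sum>j<m. fscale (w ^ (j * l)) ((conj_op g ^^ l) f))"
        unfolding p_def by (rule sum.swap)
      also have "\<dots> = (\<Sum>l<m. fscale (if l = 0 then of_nat m else 0) ((conj_op g ^^ l) f))"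
        by (rule sum.cong) (simp_all add: funs.scale_sum_left[symmetric] w_def sum_powers_root_of_unity)
      also have "\<dots> = (\<Sum>l\<in>{0}. fscale (if l = 0 then of_nat m else 0) ((conj_op g ^^ l) f))"
        using assms(4) by (intro sum.mono_neutral_right) auto
      finally have "(\<Sum>j<m. p j) = fscale (of_nat m) f" by simp
      then show ?thesis
        using assms(4) by (simp add: funs.scale_sum_right[symmetric])
    qed
    show ?thesis
      by (subst f_sum) (intro funs.span_sum funs.span_scale funs.span_base p_D)
  qed
  then have "funs.span (?D \<Delta>) \<subseteq> funs.span (?D (insert g \<Delta>))"
    by (intro funs.span_minimal subsetI funs.subspace_span)
  then show ?case using insert.IH insert.prems by blast
qed

proposition periodic_finite_dim:
  assumes fp: "finitely_presented G" and \<Gamma>: "finite \<Gamma>" "carrier G = generate G \<Gamma>"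
  shows "\<exists>B. finite B \<and> (\<forall>m>0. periodic \<Gamma> m \<subseteq> funs.span B)"
proof -
  obtain B where B: "finite B"
    "\<And>z. \<forall>g\<in>\<Gamma>. norm (z g) = 1 \<Longrightarrow> eigenspace \<Gamma> z \<subseteq> funs.span B"
    using eigenspaces_finite_dim[OF assms] by (elim exE conjE) simp
  have "periodic \<Gamma> m \<subseteq> funs.span B" if m: "m > 0" for m
  proof -
    let ?D = "{f \<in> periodic \<Gamma> m. \<forall>g\<in>\<Gamma>. \<exists>\<zeta>. norm \<zeta> = 1 \<and> conj_op g f = fscale \<zeta> f}"
    have "f \<in> funs.span B" if f: "f \<in> ?D" for f
    proof -
      have "\<forall>g\<in>\<Gamma>. \<exists>\<zeta>. norm \<zeta> = 1 \<and> conj_op g f = fscale \<zeta> f" using f by blast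
      from bchoice[OF this] obtain z where z: "\<forall>g\<in>\<Gamma>. norm (z g) = 1 \<and> conj_op g f = fscale (z g) f"
        by (elim exE)
      then have "f \<in> eigenspace \<Gamma> z" using f by (simp add: eigenspace_def periodic_def)
      then show ?thesis using B(2)[of z] z by auto
    qed
    then have "funs.span ?D \<subseteq> funs.span B"
      by (intro funs.span_minimal subsetI funs.subspace_span)
    moreover have "periodic \<Gamma> m \<subseteq> funs.span ?D"
      using \<Gamma> m by (intro periodic_spanned_by_eigenvectors) (auto intro: generate.incl)
    ultimately show ?thesis by (rule subset_trans[rotated])
  qed
  then show ?thesis using B(1) by (intro exI[of _ B]) simp
qed

end

section \<open>Homomorphisms from subgroups of finite index\<close>

lemma (in group) finite_index_power:
  assumes S: "subgroup S G" and "finite (rcosets S)"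
  shows "\<exists>m>0. \<forall>g\<in>carrier G. g [^] (m::nat) \<in> S"
proof (intro exI conjI ballI)
  let ?N = "card (rcosets S)"
  show "(fact ?N :: nat) > 0" by simp
  fix g assume g: "g \<in> carrier G"
  have "(\<lambda>i. S #> g [^] i) ` {..?N} \<subseteq> rcosets S"
    using g S by (auto simp: RCOSETS_def)
  then have "\<not> inj_on (\<lambda>i::nat. S #> g [^] i) {..?N}"
    using card_inj_on_le[OF _ _ assms(2), of "\<lambda>i. S #> g [^] i" "{..?N}"] by auto
  then obtain i j :: nat where ij: "i < j" "j \<le> ?N" "S #> g [^] i = S #> g [^] j"
    unfolding inj_on_def by (metis atMost_iff linorder_neqE_nat)
  have "g [^] j \<in> S #> g [^] i"
    using ij(3) g rcos_self[OF _ S] by simp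
  then obtain s where s: "s \<in> S" "g [^] j = s \<otimes> g [^] i" by (auto simp: r_coset_def)
  have "g [^] j = g [^] (j - i) \<otimes> g [^] i"
    using g ij by (simp add: nat_pow_mult)
  then have "g [^] (j - i) = s"
    using s g subgroup.mem_carrier[OF S, of s] by simp
  then have pow: "g [^] (j - i) \<in> S" using s by simp
  have "j - i dvd fact ?N" using ij by (intro dvd_fact) auto
  then obtain k where "fact ?N = (j - i) * k" by (rule dvdE)
  then have "g [^] (fact ?N :: nat) = (g [^] (j - i)) [^] k" using g by (simp add: nat_pow_pow)
  moreover have "(g [^] (j - i)) [^] n \<in> S" for n :: nat
  proof (induction n)
    case 0
    show ?case using subgroup.one_closed[OF S] by simp
  next
    case (Suc n)
    show ?case unfolding nat_pow_Suc using Suc pow by (rule subgroup.m_closed[OF S])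
  qed
  ultimately show "g [^] (fact ?N :: nat) \<in> S" by simp
qed

lemma (in group) conj_pow:
  assumes "x \<in> carrier G" "a \<in> carrier G"
  shows "(x \<otimes> a \<otimes> inv x) [^] (m::nat) = x \<otimes> a [^] m \<otimes> inv x"
proof (induction m)
  case (Suc m)
  have "inv x \<otimes> (x \<otimes> (a \<otimes> inv x)) = a \<otimes> inv x"
    using assms by (simp add: m_assoc[symmetric])
  moreover have "(x \<otimes> a \<otimes> inv x) [^] Suc m = (x \<otimes> a [^] m \<otimes> inv x) \<otimes> (x \<otimes> a \<otimes> inv x)"
    by (simp add: Suc)
  ultimately show ?case using assms by (simp add: m_assoc)
qed (use assms in simp)

text \<open>Homomorphisms from a subset closed under multiplication to an additive group.\<close>

definition additive_on :: "('g, 'm) monoid_scheme \<Rightarrow> 'g set \<Rightarrow> ('g \<Rightarrow> 'v::ab_group_add) \<Rightarrow> bool" where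
  "additive_on G S \<phi> \<longleftrightarrow> (\<forall>s\<in>S. \<forall>t\<in>S. \<phi> (s \<otimes>\<^bsub>G\<^esub> t) = \<phi> s + \<phi> t)"

context group
begin

context
  fixes S and \<phi> :: "'a \<Rightarrow> complex"
  assumes S: "subgroup S G" and \<phi>: "additive_on G S \<phi>"
begin

lemma additive_mult: "s \<in> S \<Longrightarrow> t \<in> S \<Longrightarrow> \<phi> (s \<otimes> t) = \<phi> s + \<phi> t"
  using \<phi> by (simp add: additive_on_def)

lemma additive_one: "\<phi> \<one> = 0"
  using additive_mult[of \<one> \<one>] subgroup.one_closed[OF S] by simp

lemma additive_inv: "s \<in> S \<Longrightarrow> \<phi> (inv s) = - \<phi> s"
  using additive_mult[of "inv s" s] subgroup.m_inv_closed[OF S] additive_one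
    subgroup.mem_carrier[OF S] by (simp add: eq_neg_iff_add_eq_0)

lemma additive_pow: "s \<in> S \<Longrightarrow> s [^] (m::nat) \<in> S \<and> \<phi> (s [^] m) = of_nat m * \<phi> s"
  by (induction m)
     (auto simp: additive_one additive_mult subgroup.one_closed[OF S] subgroup.m_closed[OF S] algebra_simps)

lemma additive_conj: "s \<in> S \<Longrightarrow> t \<in> S \<Longrightarrow> \<phi> (s \<otimes> t \<otimes> inv s) = \<phi> t"
  by (simp add: additive_mult additive_inv subgroup.m_closed[OF S] subgroup.m_inv_closed[OF S])

end

end

context abelian_by_abelian
begin

text \<open>
  If \<open>\<phi>\<close> vanishes on \<open>S \<inter> A\<close>, then \<open>g \<mapsto> \<phi> (g\<^sup>m)\<close> is a homomorphism on \<open>G\<close>, as \<open>(x y)\<^sup>m\<close> and \<open>x\<^sup>m y\<^sup>m\<close>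
  differ by an element of \<open>S \<inter> A\<close>.
\<close>

lemma additive_vanishing:
  assumes S: "subgroup S G" and \<phi>: "additive_on G S \<phi>"
    and \<Gamma>: "carrier G = generate G \<Gamma>"
    and m: "m > 0" "\<And>g. g \<in> carrier G \<Longrightarrow> g [^] (m::nat) \<in> S"
    and van: "\<And>g. g \<in> A \<union> \<Gamma> \<Longrightarrow> \<phi> (g [^] m) = (0::complex)" and s: "s \<in> S"
  shows "\<phi> s = 0"
proof -
  note pow = G.additive_pow[OF S \<phi>]
  have A: "\<phi> a = 0" if "a \<in> A" "a \<in> S" for a
    using pow[OF that(2), of m] van[of a] that m(1) by simp
  have mult: "\<phi> ((x \<otimes> y) [^] m) = \<phi> (x [^] m) + \<phi> (y [^] m)" if xy: "x \<in> carrier G" "y \<in> carrier G" for x y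
  proof -
    let ?u = "(x \<otimes> y) [^] m" and ?v = "x [^] m \<otimes> y [^] m"
    have uv: "?u \<in> S" "?v \<in> S" "?v \<in> carrier G" "?u \<in> carrier G"
      using m(2) xy by (simp_all add: subgroup.m_closed[OF S])
    have "h ?u = h ?v"
      using xy by (simp add: h.hom_nat_pow Q.pow_mult_distrib Q.m_comm)
    then have "inv ?v \<otimes> ?u \<in> A" using uv by (simp add: kernel_def del: h.hom_nat_pow)
    moreover have d: "inv ?v \<otimes> ?u \<in> S"
      using uv by (simp add: subgroup.m_closed[OF S] subgroup.m_inv_closed[OF S] del: G.inv_mult_group)
    ultimately have "\<phi> (inv ?v \<otimes> ?u) = 0" by (rule A)
    then have "\<phi> ?u = \<phi> ?v"
      using uv G.additive_mult[OF S \<phi>, of "inv ?v" ?u] G.additive_inv[OF S \<phi>, of ?v]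
        subgroup.m_inv_closed[OF S] by simp
    then show ?thesis using G.additive_mult[OF S \<phi>] m(2) xy by simp
  qed
  have "\<phi> (g [^] m) = 0" if "g \<in> generate G \<Gamma>" for g
    using that
  proof induction
    case one
    show ?case using G.additive_one[OF S \<phi>] by simp
  next
    case (incl g)
    then show ?case using van by blast
  next
    case (inv g)
    then have g: "g \<in> carrier G" using \<Gamma> by (auto intro: generate.incl)
    then show ?case
      using mult[of "inv g" g] van[of g] inv G.additive_one[OF S \<phi>] by simp
  next
    case (eng x y)
    then show ?case using mult[of x y] \<Gamma> by simp
  qed
  then have "\<phi> (s [^] m) = 0" using \<Gamma> subgroup.mem_carrier[OF S s] by simp
  then show ?thesis using pow[OF s, of m] m(1) by simp
qed

lemma conj_op_pow:
  assumes g: "g \<in> carrier G" and f: "f \<in> functionals"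
  shows "(conj_op g ^^ m) f = conj_op (g [^] m) f"
proof (induction m)
  case 0
  show ?case using f by (auto simp: functionals_def conj_op_def fun_eq_iff A_carrier)
next
  case (Suc m)
  then show ?case using g by (simp add: conj_op_conj_op)
qed

text \<open>
  A homomorphism on a subgroup \<open>S\<close> that contains all \<open>m\<close>-th powers restricts to a functional on the
  \<open>m\<close>-th powers in \<open>A\<close>, which by division extends to \<open>A\<close>.
\<close>

lemma additive_periodic:
  assumes S: "subgroup S G" and \<phi>: "additive_on G S \<phi>" and \<Gamma>: "\<Gamma> \<subseteq> carrier G"
    and m: "\<And>g. g \<in> carrier G \<Longrightarrow> g [^] (m::nat) \<in> S"
  shows "(\<lambda>a. if a \<in> A then \<phi> (a [^] m) / of_nat m else 0) \<in> periodic \<Gamma> m" (is "?f \<in> _")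
proof -
  have f: "?f \<in> functionals"
    using m G.additive_mult[OF S \<phi>]
    by (auto simp: functionals_def A_carrier G.pow_mult_distrib[OF kernel_comm] add_divide_distrib)
  moreover have "conj_op (g [^] m) ?f = ?f" if g: "g \<in> \<Gamma>" for g
  proof
    fix a
    have gG: "g \<in> carrier G" "g [^] m \<in> carrier G" "g [^] m \<in> S" using g \<Gamma> m by auto
    have "\<phi> ((g [^] m \<otimes> a \<otimes> inv (g [^] m)) [^] m) = \<phi> (a [^] m)" if "a \<in> A"
      using that gG m by (simp only: G.conj_pow A_carrier G.additive_conj[OF S \<phi>])
    then show "conj_op (g [^] m) ?f a = ?f a"
      using gG by (simp add: conj_op_def)
  qed
  ultimately show ?thesis
    using \<Gamma> conj_op_pow[OF _ f, of _ m] by (auto simp: periodic_def subset_iff)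
qed

text \<open>
  By \<open>additive_vanishing\<close> a homomorphism \<open>\<phi>\<close> on \<open>S\<close> is determined by the values of \<open>\<phi> (g\<^sup>m) / m\<close> on \<open>A\<close>
  and on the generators. The part on \<open>A\<close> is periodic and the rest contributes at most one dimension
  for each generator, so that the bound does not depend on \<open>S\<close>.
\<close>

proposition additive_bounded:
  assumes fp: "finitely_presented G" and \<Gamma>: "finite \<Gamma>" "carrier G = generate G \<Gamma>"
  shows "\<exists>n. \<forall>S \<phi>. subgroup S G \<longrightarrow> finite (rcosets S) \<longrightarrow> (\<forall>i\<le>n. additive_on G S (\<phi> i)) \<longrightarrow>
    (\<exists>c :: nat \<Rightarrow> complex. (\<exists>i\<le>n. c i \<noteq> 0) \<and> (\<forall>s\<in>S. (\<Sum>i\<le>n. c i * \<phi> i s) = 0))"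
proof -
  obtain B where B: "finite B" "\<And>m. m > 0 \<Longrightarrow> periodic \<Gamma> m \<subseteq> funs.span B"
    using periodic_finite_dim[OF assms] by (elim exE conjE) simp
  have \<Gamma>G: "\<Gamma> \<subseteq> carrier G" using \<Gamma>(2) by (auto intro: generate.incl)
  define \<delta> where "\<delta> g = (\<lambda>g'. if g' = g then 1 else 0 :: complex)" for g :: 'a
  define B' where "B' = B \<union> \<delta> ` \<Gamma>"
  have B': "finite B'" using B(1) \<Gamma>(1) by (simp add: B'_def)
  show ?thesis
  proof (intro exI[of _ "card B'"] allI impI)
    fix S and \<phi> :: "nat \<Rightarrow> 'a \<Rightarrow> complex"
    assume S: "subgroup S G" "finite (rcosets S)" and \<phi>: "\<forall>i\<le>card B'. additive_on G S (\<phi> i)"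
    obtain m :: nat where "m > 0 \<and> (\<forall>g\<in>carrier G. g [^] m \<in> S)"
      using G.finite_index_power[OF S] by (rule exE)
    then have m: "m > 0" "\<And>g. g \<in> carrier G \<Longrightarrow> g [^] m \<in> S" by simp_all
    define f where "f i = (\<lambda>g. if g \<in> A \<union> \<Gamma> then \<phi> i (g [^] m) / of_nat m else 0)" for i
    have "f i \<in> funs.span B'" if i: "i \<le> card B'" for i
    proof -
      let ?f = "\<lambda>a. if a \<in> A then \<phi> i (a [^] m) / of_nat m else 0"
      have "additive_on G S (\<phi> i)" using \<phi> i by simp
      then have "?f \<in> periodic \<Gamma> m"
        by (rule additive_periodic[OF S(1) _ \<Gamma>G m(2)])
      then have "?f \<in> funs.span B"
        using B(2)[OF m(1)] by (rule subsetD[rotated])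
      then have f1: "?f \<in> funs.span B'"
        by (rule subsetD[OF funs.span_mono, rotated]) (simp add: B'_def)
      have f2: "(\<Sum>g\<in>\<Gamma> - A. fscale (f i g) (\<delta> g)) \<in> funs.span B'"
        by (intro funs.span_sum funs.span_scale funs.span_base) (auto simp: B'_def)
      have f_eq: "f i = ?f + (\<Sum>g\<in>\<Gamma> - A. fscale (f i g) (\<delta> g))"
      proof
        fix x
        show "f i x = (?f + (\<Sum>g\<in>\<Gamma> - A. fscale (f i g) (\<delta> g))) x"
          using \<Gamma>(1) by (auto simp: fscale_apply sum_fun_apply \<delta>_def f_def if_distrib[of "\<lambda>x. _ * x"] cong: if_cong)
      qed
      show ?thesis by (subst f_eq) (rule funs.span_add[OF f1 f2])
    qed
    then obtain c where c: "\<exists>i\<in>{..card B'}. c i \<noteq> 0" "(\<Sum>i\<le>card B'. fscale (c i) (f i)) = 0"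
      using funs.many_vectors_dependent[OF B', of "{..card B'}" f] by auto
    define \<psi> where "\<psi> s = (\<Sum>i\<le>card B'. c i * \<phi> i s)" for s
    have "additive_on G S \<psi>"
      using \<phi> by (auto simp: additive_on_def \<psi>_def sum.distrib[symmetric] algebra_simps intro!: sum.cong)
    moreover have "\<psi> (g [^] m) = 0" if g: "g \<in> A \<union> \<Gamma>" for g
    proof -
      have "(\<Sum>i\<le>card B'. c i * (\<phi> i (g [^] m) / of_nat m)) = 0"
        using fun_cong[OF c(2), of g] g by (simp add: fscale_apply sum_fun_apply f_def)
      then show ?thesis using m(1) by (simp add: \<psi>_def sum_divide_distrib[symmetric])
    qed
    ultimately have "\<psi> s = 0" if "s \<in> S" for s
      using additive_vanishing[OF S(1) _ \<Gamma>(2) m _ that] by blast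
    then show "\<exists>c :: nat \<Rightarrow> complex. (\<exists>i\<le>card B'. c i \<noteq> 0) \<and> (\<forall>s\<in>S. (\<Sum>i\<le>card B'. c i * \<phi> i s) = 0)"
      using c(1) by (intro exI[of _ c]) (auto simp: \<psi>_def)
  qed
qed

end

section \<open>Homomorphisms and the first homology group\<close>

lemma (in operator_space) separating_functional:
  assumes "subspace W" "v \<notin> W"
  shows "\<exists>l. Vector_Spaces.linear scale (*) l \<and> (\<forall>w\<in>W. l w = 0) \<and> l v = 1"
proof -
  interpret pair: vector_space_pair scale "(*) :: 'a \<Rightarrow> 'a \<Rightarrow> 'a"
    by unfold_locales (simp_all add: algebra_simps)
  obtain b where b: "b \<subseteq> W" "independent b" "W \<subseteq> span b"
    using maximal_independent_subset[of W] by blast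
  have "span b \<subseteq> W" using b(1) assms(1) by (rule span_minimal)
  then have v: "v \<notin> span b" using assms(2) by blast
  then have "v \<notin> b" using span_base by blast
  have "independent (insert v b)" using v b(2) by (rule independent_insertI)
  from pair.linear_independent_extend[OF this, of "\<lambda>x. if x = v then 1 else 0"]
  obtain l where l: "Vector_Spaces.linear scale (*) l" "\<forall>x\<in>insert v b. l x = (if x = v then 1 else 0)"
    by blast
  interpret l: Vector_Spaces.linear scale "(*)" l by (rule l(1))
  have "b \<subseteq> {x. l x = 0}" using l(2) \<open>v \<notin> b\<close> by auto
  moreover have "subspace {x. l x = 0}" by (rule l.subspace_kernel)
  ultimately have "span b \<subseteq> {x. l x = 0}" by (rule span_minimal)
  then show ?thesis using b(3) l by auto
qed

global_interpretation rat_chains: operator_space "rat_scale :: rat \<Rightarrow> ('k \<Rightarrow>\<^sub>0 rat) \<Rightarrow> _"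
  by unfold_locales (simp_all add: rat_scale_simps)

lemma poly_mapping_sum_singles:
  "c = (\<Sum>k\<in>Poly_Mapping.keys c. rat_scale (Poly_Mapping.lookup c k) (Poly_Mapping.single k 1))"
  by (rule poly_mapping_eqI)
     (auto simp: lookup_sum lookup_single when_def in_keys_iff sum.delta' if_distrib cong: if_cong)

lemma subspace_bar_boundaries: "rat_chains.subspace (bar_boundaries G n)"
proof (rule rat_chains.subspaceI)
  have "bar_boundary G 0 \<in> bar_boundaries G n"
    unfolding bar_boundaries_def by (intro imageI bar_chains_ops(1))
  then show "0 \<in> bar_boundaries G n" by (simp add: bar_boundary_def)
  fix c d assume "c \<in> bar_boundaries G n" "d \<in> bar_boundaries G n"
  then obtain c' d' where "c' \<in> carrier (bar_chains G (Suc n))" "d' \<in> carrier (bar_chains G (Suc n))"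
    "c = bar_boundary G c'" "d = bar_boundary G d'"
    by (auto simp: bar_boundaries_def)
  then show "c + d \<in> bar_boundaries G n"
    by (auto simp: bar_boundaries_def bar_boundary_add[symmetric] add_bar_chains)
next
  fix r c assume "c \<in> bar_boundaries G n"
  then obtain c' where "c' \<in> carrier (bar_chains G (Suc n))" "c = bar_boundary G c'"
    by (auto simp: bar_boundaries_def)
  then show "rat_scale r c \<in> bar_boundaries G n"
    by (auto simp: bar_boundaries_def bar_boundary_scale[symmetric] rat_scale_bar_chains)
qed

lemma product_boundary:
  assumes "g \<in> carrier G" "k \<in> carrier G"
  shows "Poly_Mapping.single [k] 1 - Poly_Mapping.single [g \<otimes>\<^bsub>G\<^esub> k] 1 + Poly_Mapping.single [g] 1
    \<in> bar_boundaries G 1"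
proof -
  have "bar_boundary G (Poly_Mapping.single [g, k] 1) = bar_basis_boundary G [g, k]"
    by (simp add: bar_boundary_def rat_scale_simps)
  moreover have "Poly_Mapping.single [g, k] 1 \<in> carrier (bar_chains G (Suc 1))"
    using assms by (simp add: bar_chains_def)
  ultimately show ?thesis
    unfolding bar_boundaries_def bar_basis_boundary_2[symmetric] by (metis image_eqI)
qed

text \<open>The class of a chain modulo boundaries; it is a homology class when the chain is a cycle.\<close>

definition homology_class :: "('g, 'm) monoid_scheme \<Rightarrow> nat \<Rightarrow> ('g list \<Rightarrow>\<^sub>0 rat) \<Rightarrow> ('g list \<Rightarrow>\<^sub>0 rat) set" where
  "homology_class G n c = (\<lambda>b. b + c) ` bar_boundaries G n"

lemma homology_class_eq:
  assumes "c - d \<in> bar_boundaries G n"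
  shows "homology_class G n c = homology_class G n d"
proof -
  have "homology_class G n c \<subseteq> homology_class G n d" if "c - d \<in> bar_boundaries G n" for c d
  proof -
    have "b + c = (b + (c - d)) + d" "b + (c - d) \<in> bar_boundaries G n" if "b \<in> bar_boundaries G n" for b
      using that \<open>c - d \<in> _\<close> rat_chains.subspace_add[OF subspace_bar_boundaries] by auto
    then show ?thesis unfolding homology_class_def by blast
  qed
  moreover have "d - c \<in> bar_boundaries G n"
    using rat_chains.subspace_neg[OF subspace_bar_boundaries assms] by simp
  ultimately show ?thesis using assms by blast
qed

lemma homology_class_ops:
  "homology_class G n c \<oplus>\<^bsub>rational_homology G n\<^esub> homology_class G n d = homology_class G n (c + d)"
  "r \<odot>\<^bsub>rational_homology G n\<^esub> homology_class G n c = homology_class G n (rat_scale r c)"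
  "\<zero>\<^bsub>rational_homology G n\<^esub> = homology_class G n 0"
  "carrier (rational_homology G n) = homology_class G n ` bar_cycles G n"
proof -
  note sub = rat_chains.subspace_0[OF subspace_bar_boundaries]
    rat_chains.subspace_add[OF subspace_bar_boundaries]
    rat_chains.subspace_scale[OF subspace_bar_boundaries]
  have coset: "bar_boundaries G n +>\<^bsub>(bar_chains G n)\<lparr>carrier := C\<rparr>\<^esub> c = homology_class G n c" for C c
    by (auto simp: a_r_coset_def r_coset_def homology_class_def bar_chains_def)
  show "carrier (rational_homology G n) = homology_class G n ` bar_cycles G n"
    by (auto simp: rational_homology_def quotient_module_def A_RCOSETS_def' coset)
  show "\<zero>\<^bsub>rational_homology G n\<^esub> = homology_class G n 0"
    by (simp add: rational_homology_def quotient_module_def homology_class_def)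
  show "homology_class G n c \<oplus>\<^bsub>rational_homology G n\<^esub> homology_class G n d = homology_class G n (c + d)"
  proof -
    have "homology_class G n c \<oplus>\<^bsub>rational_homology G n\<^esub> homology_class G n d
      = {x + y | x y. x \<in> homology_class G n c \<and> y \<in> homology_class G n d}"
      by (auto simp: rational_homology_def quotient_module_def set_add_def set_mult_def bar_chains_def)
    also have "\<dots> = homology_class G n (c + d)"
    proof (intro equalityI subsetI)
      fix x assume "x \<in> {x + y | x y. x \<in> homology_class G n c \<and> y \<in> homology_class G n d}"
      then obtain b b' where "b \<in> bar_boundaries G n" "b' \<in> bar_boundaries G n"
        "x = (b + c) + (b' + d)" by (auto simp: homology_class_def)
      then have "x = (b + b') + (c + d)" "b + b' \<in> bar_boundaries G n"
        by (simp_all add: sub add_ac)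
      then show "x \<in> homology_class G n (c + d)" by (auto simp: homology_class_def)
    next
      fix x assume "x \<in> homology_class G n (c + d)"
      then obtain b where "b \<in> bar_boundaries G n" "x = (b + c) + (0 + d)"
        by (auto simp: homology_class_def add_ac)
      then show "x \<in> {x + y | x y. x \<in> homology_class G n c \<and> y \<in> homology_class G n d}"
        unfolding homology_class_def using sub(1) by blast
    qed
    finally show ?thesis .
  qed
  show "r \<odot>\<^bsub>rational_homology G n\<^esub> homology_class G n c = homology_class G n (rat_scale r c)"
  proof -
    have "r \<odot>\<^bsub>rational_homology G n\<^esub> homology_class G n c
      = (\<Union>v\<in>homology_class G n c. homology_class G n (rat_scale r v))"
      by (simp add: rational_homology_def quotient_module_def coset) (simp add: bar_chains_def)
    also have "\<dots> = (\<Union>v\<in>homology_class G n c. homology_class G n (rat_scale r c))"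
    proof (rule SUP_cong[OF refl])
      fix v assume "v \<in> homology_class G n c"
      then obtain b where b: "b \<in> bar_boundaries G n" "v = b + c" by (auto simp: homology_class_def)
      then have "rat_scale r v - rat_scale r c = rat_scale r b" by (simp add: rat_scale_simps)
      then show "homology_class G n (rat_scale r v) = homology_class G n (rat_scale r c)"
        using sub(3)[OF b(1)] by (intro homology_class_eq) simp
    qed
    also have "\<dots> = homology_class G n (rat_scale r c)"
      using sub(1) by (auto simp: homology_class_def)
    finally show ?thesis .
  qed
qed

text \<open>Elements \<open>s i\<close> of \<open>G\<close> and homomorphisms \<open>\<phi> i\<close> to the rationals, for \<open>i < k\<close>, that are dual to each other.\<close>

definition dual_system :: "('g, 'm) monoid_scheme \<Rightarrow> nat \<Rightarrow> (nat \<Rightarrow> 'g) \<Rightarrow> (nat \<Rightarrow> 'g \<Rightarrow> rat) \<Rightarrow> bool" where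
  "dual_system G k s \<phi> \<longleftrightarrow> (\<forall>i<k. s i \<in> carrier G \<and> additive_on G (carrier G) (\<phi> i)) \<and>
     (\<forall>i<k. \<forall>j<k. \<phi> j (s i) = (if i = j then 1 else 0))"

text \<open>
  If the class of \<open>t\<close> is not the combination of the classes of the \<open>s j\<close> with coefficients \<open>\<phi> j t\<close>,
  then a linear functional on the chains that vanishes on the boundaries but not on the difference
  gives a further homomorphism.
\<close>

lemma dual_system_extend:
  assumes D: "dual_system G k s \<phi>" and t: "t \<in> carrier G"
    and not: "Poly_Mapping.single [t] 1 - (\<Sum>j<k. rat_scale (\<phi> j t) (Poly_Mapping.single [s j] 1))
      \<notin> bar_boundaries G 1" (is "?c \<notin> _")
  shows "\<exists>s' \<phi>'. dual_system G (Suc k) s' \<phi>'"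
proof -
  obtain l where l: "Vector_Spaces.linear rat_scale (*) l" "\<forall>w\<in>bar_boundaries G 1. l w = 0" "l ?c = 1"
    using rat_chains.separating_functional[OF subspace_bar_boundaries not] by blast
  interpret l: Vector_Spaces.linear rat_scale "(*)" l by (rule l(1))
  define p where "p g = l (Poly_Mapping.single [g] 1)" for g
  have p: "p (g \<otimes>\<^bsub>G\<^esub> g') = p g + p g'" if "g \<in> carrier G" "g' \<in> carrier G" for g g'
  proof -
    have "p g' - p (g \<otimes>\<^bsub>G\<^esub> g') + p g = 0"
      using product_boundary[OF that] l(2) by (simp add: p_def l.add[symmetric] l.diff[symmetric])
    then show ?thesis by simp
  qed
  define q where "q g = p g - (\<Sum>j<k. p (s j) * \<phi> j g)" for g
  have \<phi>: "\<phi> j (g \<otimes>\<^bsub>G\<^esub> g') = \<phi> j g + \<phi> j g'" if "j < k" "g \<in> carrier G" "g' \<in> carrier G" for j g g'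
    using D that by (simp add: dual_system_def additive_on_def)
  have q: "q (g \<otimes>\<^bsub>G\<^esub> g') = q g + q g'" if "g \<in> carrier G" "g' \<in> carrier G" for g g'
    using that by (simp add: q_def p \<phi> algebra_simps sum.distrib)
  have q_s: "q (s i) = 0" if "i < k" for i
  proof -
    have "(\<Sum>j<k. p (s j) * \<phi> j (s i)) = (\<Sum>j<k. if j = i then p (s j) else 0)"
      using D that by (intro sum.cong) (auto simp: dual_system_def)
    then show ?thesis using that by (simp add: q_def)
  qed
  have "q t = l ?c"
    by (simp add: q_def p_def l.diff l.sum l.scale mult.commute)
  then have q_t: "q t = 1" using l(3) by simp
  let ?s = "\<lambda>i. if i < k then s i else t"
  let ?\<phi> = "\<lambda>i g. if i < k then \<phi> i g - \<phi> i t * q g else q g"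
  have "dual_system G (Suc k) ?s ?\<phi>"
    using D t unfolding dual_system_def additive_on_def
    by (auto simp: q_s q_t q \<phi> algebra_simps less_Suc_eq)
  then show ?thesis by blast
qed

text \<open>
  In a dual system of maximal size the classes of the \<open>s i\<close> span the homology, and the size is
  bounded by the number of independent homomorphisms to the complex numbers.
\<close>

proposition edim_homology_le:
  assumes G: "group G"
    and bound: "\<And>\<phi>. \<forall>i\<le>n. additive_on G (carrier G) (\<phi> i) \<Longrightarrow>
      \<exists>c :: nat \<Rightarrow> complex. (\<exists>i\<le>n. c i \<noteq> 0) \<and> (\<forall>g\<in>carrier G. (\<Sum>i\<le>n. c i * \<phi> i g) = 0)"
  shows "edim rat_field (rational_homology G 1) \<le> enat n"
proof -
  let ?P = "\<lambda>k. \<exists>s \<phi>. dual_system G k s \<phi>"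
  have P0: "?P 0" by (simp add: dual_system_def)
  have P_le: "k \<le> n" if ex: "?P k" for k
  proof (rule ccontr)
    assume "\<not> k \<le> n"
    obtain s \<phi> where D: "dual_system G k s \<phi>" using ex by blast
    have "\<forall>i\<le>n. additive_on G (carrier G) (\<lambda>g. of_rat (\<phi> i g) :: complex)"
      using D \<open>\<not> k \<le> n\<close> by (simp add: dual_system_def additive_on_def of_rat_add)
    from bound[OF this] obtain c :: "nat \<Rightarrow> complex" where c: "\<exists>i\<le>n. c i \<noteq> 0"
      "\<forall>g\<in>carrier G. (\<Sum>i\<le>n. c i * of_rat (\<phi> i g)) = 0" by blast
    have "c i = 0" if "i \<le> n" for i
    proof -
      have "s i \<in> carrier G" using D that \<open>\<not> k \<le> n\<close> by (simp add: dual_system_def)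
      then have "(\<Sum>j\<le>n. c j * of_rat (\<phi> j (s i))) = 0" using c(2) by blast
      moreover have "(\<Sum>j\<le>n. c j * of_rat (\<phi> j (s i))) = (\<Sum>j\<le>n. if j = i then c j else 0)"
        using D that \<open>\<not> k \<le> n\<close> by (intro sum.cong) (auto simp: dual_system_def)
      ultimately show ?thesis using that by simp
    qed
    then show False using c(1) by blast
  qed
  obtain k where k: "?P k" "\<And>j. ?P j \<Longrightarrow> j \<le> k"
    using Nat.ex_has_greatest_nat[of ?P 0 n] P0 P_le by blast
  then obtain s \<phi> where D: "dual_system G k s \<phi>" by blast
  have s: "s i \<in> carrier G" if "i < k" for i using D that by (simp add: dual_system_def)
  have rel: "Poly_Mapping.single [t] 1 - (\<Sum>j<k. rat_scale (\<phi> j t) (Poly_Mapping.single [s j] 1))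
      \<in> bar_boundaries G 1" if "t \<in> carrier G" for t
    using dual_system_extend[OF D that] k(2)[of "Suc k"] by auto
  interpret V: vectorspace rat_field "rational_homology G 1"
    by (rule vectorspace_rational_homology_1[OF G])
  define X where "X = (\<lambda>i. homology_class G 1 (Poly_Mapping.single [s i] 1)) ` {..<k}"
  have carr: "carrier (rational_homology G 1) = homology_class G 1 ` carrier (bar_chains G 1)"
    unfolding homology_class_ops bar_cycles_1 ..
  have X: "X \<subseteq> carrier (rational_homology G 1)"
    unfolding X_def carr using s by (auto simp: bar_chains_def simp del: One_nat_def)
  interpret span: LinearCombinations.submodule rat_field "V.span X" "rational_homology G 1"
    by (rule V.span_is_submodule[OF X])
  let ?W = "{c. homology_class G 1 c \<in> V.span X}"
  have W_add: "c + d \<in> ?W" if "c \<in> ?W" "d \<in> ?W" for c d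
    using that span.m_closed[of "homology_class G 1 c" "homology_class G 1 d"]
    by (simp add: homology_class_ops)
  have W_scale: "rat_scale r c \<in> ?W" if "c \<in> ?W" for r c
    using that span.smult_closed[of r "homology_class G 1 c"]
    by (simp add: homology_class_ops rat_field_def)
  have W_0: "0 \<in> ?W"
    using span.zero_closed by (simp add: homology_class_ops)
  have W_sum: "sum f I \<in> ?W" if "\<And>i. i \<in> I \<Longrightarrow> f i \<in> ?W" for f :: "'c \<Rightarrow> _" and I
    using that by (induction I rule: infinite_finite_induct) (use W_add W_0 in auto)
  have W_s: "Poly_Mapping.single [s i] 1 \<in> ?W" if "i < k" for i
    using V.in_own_span[OF X] that by (auto simp: X_def)
  have W_t: "Poly_Mapping.single [t] 1 \<in> ?W" if t: "t \<in> carrier G" for t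
    using homology_class_eq[OF rel[OF t]] W_sum[of "{..<k}"] W_scale W_s by simp
  have "c \<in> ?W" if "c \<in> carrier (bar_chains G 1)" for c
  proof -
    have "Poly_Mapping.single gs 1 \<in> ?W" if gs: "gs \<in> Poly_Mapping.keys c" for gs
    proof -
      have "length gs = 1" "set gs \<subseteq> carrier G"
        using gs \<open>c \<in> _\<close> by (auto simp: bar_chains_def)
      then obtain t where "gs = [t]" "t \<in> carrier G" by (cases gs) auto
      then show ?thesis using W_t by simp
    qed
    then have "(\<Sum>gs\<in>Poly_Mapping.keys c. rat_scale (Poly_Mapping.lookup c gs) (Poly_Mapping.single gs 1)) \<in> ?W"
      by (intro W_sum W_scale)
    then show ?thesis using poly_mapping_sum_singles[of c] by simp
  qed
  then have "carrier (rational_homology G 1) \<subseteq> V.span X"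
    unfolding carr by blast
  then have gen: "V.gen_set X" using V.span_is_subset2[OF X] by blast
  have "finite X" by (simp add: X_def)
  then have fin: "V.fin_dim" using X gen unfolding V.fin_dim_def by blast
  have "V.dim \<le> card X" using V.gen_ge_dim[OF \<open>finite X\<close> X gen] by simp
  also have "\<dots> \<le> k" unfolding X_def using card_image_le[of "{..<k}"] by simp
  also have "\<dots> \<le> n" by (rule P_le[OF k(1)])
  finally show ?thesis using fin by (simp add: edim_def)
qed

section \<open>The virtual first Betti number\<close>

theorem theorem4p3:
  fixes A :: "'a monoid" and G :: "'g monoid" and Q :: "'q monoid"
    and f :: "'a \<Rightarrow> 'g" and h :: "'g \<Rightarrow> 'q"
  assumes "comm_group A" and "group G" and "comm_group Q"
    and "f \<in> mon A G" and "h \<in> epi G Q"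
    and "f ` carrier A = kernel G Q h"
    and "finitely_presented G"
  shows "vb1 G < \<infinity>"
proof -
  interpret A: comm_group A by fact
  interpret G: group G by fact
  interpret Q: comm_group Q by fact
  have f: "f \<in> hom A G" using assms(4) by (simp add: mon_def)
  interpret E: abelian_by_abelian G Q h
  proof unfold_locales
    fix a b assume "a \<in> kernel G Q h" "b \<in> kernel G Q h"
    then obtain x y where "x \<in> carrier A" "y \<in> carrier A" "a = f x" "b = f y"
      unfolding assms(6)[symmetric] by blast
    then show "a \<otimes>\<^bsub>G\<^esub> b = b \<otimes>\<^bsub>G\<^esub> a"
      using hom_mult[OF f, of x y] hom_mult[OF f, of y x] by (simp add: A.m_comm)
  qed fact
  obtain e :: "nat \<Rightarrow> 'g" where e: "finite (range e)" "carrier G = generate G (range e)"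
    using assms(7,2) by (rule finitely_presentedE)
  obtain n where n: "\<forall>S \<phi>. subgroup S G \<longrightarrow> finite (rcosets\<^bsub>G\<^esub> S) \<longrightarrow> (\<forall>i\<le>n. additive_on G S (\<phi> i)) \<longrightarrow>
    (\<exists>c :: nat \<Rightarrow> complex. (\<exists>i\<le>n. c i \<noteq> 0) \<and> (\<forall>s\<in>S. (\<Sum>i\<le>n. c i * \<phi> i s) = 0))"
    using E.additive_bounded[OF assms(7) e] by (rule exE)
  have "edim rat_field (rational_homology (G\<lparr>carrier := S\<rparr>) 1) \<le> enat n"
    if S: "subgroup S G" "finite (rcosets\<^bsub>G\<^esub> S)" for S
  proof (rule edim_homology_le)
    show "group (G\<lparr>carrier := S\<rparr>)"
      using S(1) G.is_group by (rule subgroup.subgroup_is_group)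
    fix \<phi> :: "nat \<Rightarrow> 'g \<Rightarrow> complex"
    assume "\<forall>i\<le>n. additive_on (G\<lparr>carrier := S\<rparr>) (carrier (G\<lparr>carrier := S\<rparr>)) (\<phi> i)"
    then have "\<forall>i\<le>n. additive_on G S (\<phi> i)" by (simp add: additive_on_def)
    with n S show "\<exists>c :: nat \<Rightarrow> complex. (\<exists>i\<le>n. c i \<noteq> 0) \<and>
      (\<forall>g\<in>carrier (G\<lparr>carrier := S\<rparr>). (\<Sum>i\<le>n. c i * \<phi> i g) = 0)"
      by simp
  qed
  then have "vb1 G \<le> enat n" unfolding vb1_def by (intro SUP_least) simp
  also have "enat n < \<infinity>" by simp
  finally show ?thesis .
qed

end
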